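(* Consider entropy-seeking and information-seeking agents with finite horizon $m=m(t)<\infty$, which may depend on the time step $t$ through any computable function $m:\mathbb{N}\to\mathbb{N}$ with $m(t)\ge t$. For both kinds of agents there are limit-computable $\varepsilon$-optimal policies and $\Delta^0_3$-computable optimal policies. That is, for $X\in\{\mathrm{Ent},\mathrm{IG}\}$: (i) for every $\varepsilon>0$ there are deterministic policies $(\pi^t)_{t\in\mathbb{N}}$, limit computable ($\Delta^0_2$) uniformly in $t$, such that for every $t$ the policy $\pi^t$ is $\varepsilon$-optimal for the horizon $m(t)$, i.e. $V^{*,m(t)}_X(\ae_{<k})-V^{\pi^t,m(t)}_X(\ae_{<k})<\varepsilon$ for all histories $\ae_{<k}$; (ii) there are deterministic policies $(\pi^t)_{t\in\mathbb{N}}$, $\Delta^0_3$ uniformly in $t$, such that for every $t$ the policy $\pi^t$ is optimal for the horizon $m(t)$, i.e. $V^{\pi^t,m(t)}_X(\ae_{<k})=V^{*,m(t)}_X(\ae_{<k})$ for all histories $\ae_{<k}$.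
   Context: The action set $\mathcal{A}$ and percept set $\mathcal{E}$ are finite. A history is $\ae_{<k}=a_1e_1\ldots a_{k-1}e_{k-1}\in(\mathcal{A}\times\mathcal{E})^*$. Policies are deterministic maps from histories to actions, identified with their graphs, encoded computably as sets of natural numbers; $\Delta^0_n$ refers to the arithmetical hierarchy and limit computable means $\Delta^0_2$. A family $(\pi^t)_{t\in\mathbb{N}}$ is $\Delta^0_n$ uniformly in $t$ if the set of triples $(t,h,a)$ with $\pi^t(h)=a$ is $\Delta^0_n$. The horizon $m(t)$ is the one used by an agent that plans at time step $t$: it maximizes the entropy, respectively information, received up to time step $m(t)$, and $\pi^t$ is the policy it plans with at time $t$. A chronological contextual semimeasure $\nu$ assigns to all equal-length $e_{1:t}\in\mathcal{E}^t$, $a_{1:t}\in\mathcal{A}^t$ a number $\nu(e_{1:t}\,\|\,a_{1:t})\in[0,1]$ with $\nu(\epsilon\,\|\,\epsilon)\le1$ (where $\epsilon$ is the empty string) and $\sum_{e_t}\nu(e_{1:t}\,\|\,a_{1:t})\le\nu(e_{<t}\,\|\,a_{<t})$; it is a measure if equalities hold. $\mathcal{M}=\{\nu_1,\nu_2,\ldots\}$ is a countable class of uniformly lower semicomputable chronological contextual semimeasures, $w$ is a lower semicomputable prior on $\mathcal{M}$ with $w(\nu)>0$ for all $\nu$, and $\xi:=\sum_{\nu\in\mathcal{M}}w(\nu)\nu$ is assumed to be a measure. The posterior is $w(\nu\mid\ae_{<k}):=w(\nu)\,\nu(e_{<k}\,\|\,a_{<k})/\xi(e_{<k}\,\|\,a_{<k})$;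 values are considered at histories with $\xi(e_{<k}\,\|\,a_{<k})>0$. For $\rho\in\mathcal{M}\cup\{\xi\}$ and a policy $\pi$, $\rho^\pi(\,\cdot\mid\ae_{<k})$ is the distribution over continuations of $\ae_{<k}$ obtained when, from time $k$ on, actions are chosen by $\pi$ and percepts are drawn from $\rho(e_i\mid\ae_{<i}a_i)=\rho(e_{1:i}\,\|\,a_{1:i})/\rho(e_{<i}\,\|\,a_{<i})$; $\mathbb{E}^\pi_\xi[\,\cdot\mid\ae_{<k}]$ is expectation under $\xi^\pi(\,\cdot\mid\ae_{<k})$. For a horizon $m\in\mathbb{N}$, $$\mathrm{KL}_m(\nu^\pi,\xi^\pi\mid\ae_{<k})=\sum_{\ae_{k:m}}\nu^\pi(\ae_{1:m}\mid\ae_{<k})\log_2\frac{\nu^\pi(\ae_{1:m}\mid\ae_{<k})}{\xi^\pi(\ae_{1:m}\mid\ae_{<k})}$$ (terms with $\nu^\pi(\ae_{1:m}\mid\ae_{<k})=0$ count as $0$). The entropy-seeking value is $V^{\pi,m}_{\mathrm{Ent}}(\ae_{<k}):=\mathbb{E}^\pi_\xi\big[-\log_2\xi(e_{1:m}\mid e_{<k}\,\|\,a_{1:m})\mid\ae_{<k}\big]$ with $\xi(e_{1:m}\mid e_{<k}\,\|\,a_{1:m})=\xi(e_{1:m}\,\|\,a_{1:m})/\xi(e_{<k}\,\|\,a_{<k})$. The information-seeking value is $V^{\pi,m}_{\mathrm{IG}}(\ae_{<k}):=\sum_{\nu\in\mathcal{M}}w(\nu\mid\ae_{<k})\,\mathrm{KL}_m(\nu^\pi,\xi^\pi\mid\ae_{<k})$,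 where terms with $w(\nu\mid\ae_{<k})=0$ count as $0$. For $k>m$ both values are $0$. In both cases $V^{*,m}_X:=\sup_\pi V^{\pi,m}_X$. *)

theory Defs
  imports
    "HOL-Analysis.Infinite_Sum"
    "HOL-Library.Nat_Bijection"
    "HOL-Library.Countable"
begin

section \<open>Computability and the arithmetical hierarchy\<close>

text \<open>
  The total recursive functions, with their arity: the closure of the basic functions under
  composition, primitive recursion and minimisation of regular functions.  An \<open>n\<close>-ary function is
  represented on lists, and only its values on lists of length \<open>n\<close> are meaningful.  Primitive
  recursion runs over the first argument.
\<close>

inductive general_recursive :: "nat \<Rightarrow> (nat list \<Rightarrow> nat) \<Rightarrow> bool" where
  zero: "general_recursive n (\<lambda>_. 0)"
| succ: "general_recursive 1 (\<lambda>xs. Suc (xs ! 0))"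
| proj: "i < n \<Longrightarrow> general_recursive n (\<lambda>xs. xs ! i)"
| comp: "general_recursive (length gs) f \<Longrightarrow> (\<And>g. g \<in> set gs \<Longrightarrow> general_recursive n g) \<Longrightarrow>
    general_recursive n (\<lambda>xs. f (map (\<lambda>g. g xs) gs))"
| prim_rec: "general_recursive n f \<Longrightarrow> general_recursive (Suc (Suc n)) g \<Longrightarrow>
    general_recursive (Suc n)
      (\<lambda>xs. rec_nat (f (tl xs)) (\<lambda>k r. g (k # r # tl xs)) (hd xs))"
| minimise: "general_recursive (Suc n) f \<Longrightarrow> (\<forall>xs. length xs = n \<longrightarrow> (\<exists>y. f (y # xs) = 0)) \<Longrightarrow>
    general_recursive n (\<lambda>xs. LEAST y. f (y # xs) = 0)"

definition computable_fun :: "(nat \<Rightarrow> nat) \<Rightarrow> bool" where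
  "computable_fun f \<longleftrightarrow> (\<exists>g. general_recursive 1 g \<and> (\<forall>x. f x = g [x]))"

definition computable_rel :: "nat \<Rightarrow> (nat list \<Rightarrow> bool) \<Rightarrow> bool" where
  "computable_rel n R \<longleftrightarrow>
     (\<exists>f. general_recursive n f \<and> (\<forall>xs. length xs = n \<longrightarrow> (R xs \<longleftrightarrow> f xs = 0)))"

text \<open>
  A prefix of \<open>n\<close> alternating quantifiers, starting with \<open>\<exists>\<close> if the flag is \<^term>\<open>True\<close> and with
  \<open>\<forall>\<close> otherwise; the outermost quantified variable comes first in the argument list.
\<close>

fun alternating :: "bool \<Rightarrow> nat \<Rightarrow> (nat list \<Rightarrow> bool) \<Rightarrow> nat list \<Rightarrow> bool" where
  "alternating b 0 R xs \<longleftrightarrow> R xs"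
| "alternating True (Suc n) R xs \<longleftrightarrow> (\<exists>k. alternating False n R (xs @ [k]))"
| "alternating False (Suc n) R xs \<longleftrightarrow> (\<forall>k. alternating True n R (xs @ [k]))"

definition sigma0 :: "nat \<Rightarrow> nat set \<Rightarrow> bool" where
  "sigma0 n A \<longleftrightarrow> (\<exists>R. computable_rel (Suc n) R \<and> (\<forall>x. x \<in> A \<longleftrightarrow> alternating True n R [x]))"

definition pi0 :: "nat \<Rightarrow> nat set \<Rightarrow> bool" where
  "pi0 n A \<longleftrightarrow> (\<exists>R. computable_rel (Suc n) R \<and> (\<forall>x. x \<in> A \<longleftrightarrow> alternating False n R [x]))"

definition delta0 :: "nat \<Rightarrow> nat set \<Rightarrow> bool" where
  "delta0 n A \<longleftrightarrow> sigma0 n A \<and> pi0 n A"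

definition rat_of_code :: "nat \<Rightarrow> rat" where
  "rat_of_code c = (case prod_decode c of (p, q) \<Rightarrow> of_int (int_decode p) / of_nat (Suc q))"

text \<open>
  A real-valued function is lower semicomputable if the rationals strictly below its values can be
  enumerated; \<open>code\<close> encodes the arguments as natural numbers.
\<close>

definition lower_semicomputable :: "('x \<Rightarrow> nat) \<Rightarrow> ('x \<Rightarrow> real) \<Rightarrow> bool" where
  "lower_semicomputable code f \<longleftrightarrow>
     sigma0 1 {prod_encode (code x, c) | x c. of_rat (rat_of_code c) < f x}"


section \<open>Histories, policies and environments\<close>

text \<open>
  The history \<open>a\<^sub>1 e\<^sub>1 \<dots> a\<^bsub>k-1\<^esub> e\<^bsub>k-1\<^esub>\<close> is a list \<open>h\<close> of pairs, so \<open>k = length h + 1\<close>.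
  A contextual function \<open>\<nu>(e\<^bsub>1:t\<^esub> || a\<^bsub>1:t\<^esub>)\<close> takes two strings of equal length and is therefore a
  function of the zipped list \<open>[(a\<^sub>1, e\<^sub>1), \<dots>, (a\<^sub>t, e\<^sub>t)]\<close>.
\<close>

type_synonym ('a, 'e) history = "('a \<times> 'e) list"
type_synonym ('a, 'e) policy = "('a, 'e) history \<Rightarrow> 'a"
type_synonym ('a, 'e) env = "('a, 'e) history \<Rightarrow> real"

text \<open>
  On the finite alphabets \<^const>\<open>to_nat\<close> is an arbitrary injection, which is harmless, since
  any two injections of a finite set differ by a computable function.  It must not be used on
  histories: there it need not be computable.
\<close>

definition hist_code :: "('a::finite, 'e::finite) history \<Rightarrow> nat" where
  "hist_code h = list_encode (map (\<lambda>(a, e). prod_encode (to_nat a, to_nat e)) h)"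

definition policies_graph :: "(nat \<Rightarrow> ('a::finite, 'e::finite) policy) \<Rightarrow> nat set" where
  "policies_graph \<pi> = {prod_encode (t, prod_encode (hist_code h, to_nat a)) | t h a. \<pi> t h = a}"

definition chron_semimeasure :: "('a::finite, 'e::finite) env \<Rightarrow> bool" where
  "chron_semimeasure \<nu> \<longleftrightarrow>
     (\<forall>h. 0 \<le> \<nu> h \<and> \<nu> h \<le> 1) \<and> (\<forall>h a. (\<Sum>e\<in>UNIV. \<nu> (h @ [(a, e)])) \<le> \<nu> h)"

definition chron_measure :: "('a::finite, 'e::finite) env \<Rightarrow> bool" where
  "chron_measure \<nu> \<longleftrightarrow> chron_semimeasure \<nu> \<and>
     \<nu> [] = 1 \<and> (\<forall>h a. (\<Sum>e\<in>UNIV. \<nu> (h @ [(a, e)])) = \<nu> h)"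

definition uniformly_lower_semicomputable ::
    "(nat \<Rightarrow> ('a::finite, 'e::finite) env) \<Rightarrow> bool" where
  "uniformly_lower_semicomputable \<nu>s \<longleftrightarrow>
     lower_semicomputable (\<lambda>(i, h). prod_encode (i, hist_code h)) (\<lambda>(i, h). \<nu>s i h)"

text \<open>
  Only \<open>\<Sum>w \<le> 1\<close> is required; equality then follows whenever the mixture is a measure.
\<close>

definition positive_prior :: "('a, 'e) env set \<Rightarrow> (('a, 'e) env \<Rightarrow> real) \<Rightarrow> bool" where
  "positive_prior M w \<longleftrightarrow> (\<forall>\<nu>\<in>M. 0 < w \<nu>) \<and> w summable_on M \<and> (\<Sum>\<^sub>\<infinity>\<nu>\<in>M. w \<nu>) \<le> 1"

definition mixture :: "(('a, 'e) env \<Rightarrow> real) \<Rightarrow> ('a, 'e) env set \<Rightarrow> ('a, 'e) env" where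
  "mixture w M h = (\<Sum>\<^sub>\<infinity>\<nu>\<in>M. w \<nu> * \<nu> h)"

definition posterior ::
    "(('a, 'e) env \<Rightarrow> real) \<Rightarrow> ('a, 'e) env set \<Rightarrow> ('a, 'e) env \<Rightarrow> ('a, 'e) history \<Rightarrow> real" where
  "posterior w M \<nu> h = w \<nu> * \<nu> h / mixture w M h"

text \<open>
  \<open>cont_prob \<rho> \<pi> h z\<close> is \<open>\<rho>\<^sup>\<pi>(h z | h)\<close>, the probability of the continuation \<open>z\<close> of \<open>h\<close> when
  actions are chosen by \<open>\<pi>\<close> and percepts are drawn from \<open>\<rho>\<close>.
\<close>

fun cont_prob :: "('a, 'e) env \<Rightarrow> ('a, 'e) policy \<Rightarrow> ('a, 'e) history \<Rightarrow> ('a, 'e) history \<Rightarrow> real" where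
  "cont_prob \<rho> \<pi> h [] = 1"
| "cont_prob \<rho> \<pi> h ((a, e) # z) =
     (if a = \<pi> h then \<rho> (h @ [(a, e)]) / \<rho> h else 0) * cont_prob \<rho> \<pi> (h @ [(a, e)]) z"


section \<open>Entropy-seeking and information-seeking values\<close>

definition KL_div :: "nat \<Rightarrow> ('a::finite, 'e::finite) env \<Rightarrow> ('a, 'e) env \<Rightarrow>
    ('a, 'e) policy \<Rightarrow> ('a, 'e) history \<Rightarrow> real" where
  "KL_div m \<nu> \<xi> \<pi> h = (\<Sum>z | length z = m - length h.
     if cont_prob \<nu> \<pi> h z = 0 then 0
     else cont_prob \<nu> \<pi> h z * log 2 (cont_prob \<nu> \<pi> h z / cont_prob \<xi> \<pi> h z))"

definition V_Ent :: "('a::finite, 'e::finite) env \<Rightarrow>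
    ('a, 'e) policy \<Rightarrow> nat \<Rightarrow> ('a, 'e) history \<Rightarrow> real" where
  "V_Ent \<xi> \<pi> m h = (if length h < m then
     (\<Sum>z | length z = m - length h. cont_prob \<xi> \<pi> h z * (- log 2 (\<xi> (h @ z) / \<xi> h)))
     else 0)"

definition V_IG :: "(('a::finite, 'e::finite) env \<Rightarrow> real) \<Rightarrow> ('a, 'e) env set \<Rightarrow>
    ('a, 'e) policy \<Rightarrow> nat \<Rightarrow> ('a, 'e) history \<Rightarrow> real" where
  "V_IG w M \<pi> m h = (if length h < m then
     (\<Sum>\<^sub>\<infinity>\<nu>\<in>M. posterior w M \<nu> h * KL_div m \<nu> (mixture w M) \<pi> h)
     else 0)"

definition opt_value :: "(('a, 'e) policy \<Rightarrow> nat \<Rightarrow> ('a, 'e) history \<Rightarrow> real) \<Rightarrow>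
    nat \<Rightarrow> ('a, 'e) history \<Rightarrow> real" where
  "opt_value V m h = (SUP \<pi>. V \<pi> m h)"

end

theory Submission
  imports Defs "HOL-Analysis.Uniform_Limit"
begin

text \<open>
  Because the mixture \<open>\<xi>\<close> is a measure and the prior has mass at most one, every \<open>\<nu>\<close> in the class is a
  measure.  With \<open>\<eta>(x) = -x log\<^sub>2 x\<close>, the chain rule turns both \<open>\<xi>(h) V(h)\<close> into a sum of a
  function \<open>\<Phi>\<close> over the histories reached at the horizon, minus a term that does not depend on the policy:
  \<open>\<Phi> = \<eta> \<circ> \<xi>\<close> for the entropy and \<open>\<Phi>(h) = \<eta>(\<xi>(h)) - \<Sum>\<^sub>\<nu> w(\<nu>) \<eta>(\<nu>(h))\<close> for the information.
  By dominated convergence \<open>\<Phi>\<close> is a pointwise limit of computable functions, and so are the optimal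
  sums obtained from it by backward induction.  An action that is nearly greedy
  from some stage on is found by a limit-computable search, and the losses of nearly greedy actions
  add up to less than \<open>\<epsilon>\<close>.  Being exactly greedy is a \<open>\<Pi>\<^sup>0\<^sub>2\<close> property, so the least
  greedy action is \<open>\<Delta>\<^sup>0\<^sub>3\<close>.
\<close>

section \<open>Recursive functions\<close>

text \<open>Two obstacles shape the proof. \<open>M\<close> is a set, so the mixture counts each
  environment once, while the enumeration may list it infinitely often, and then the sum of the
  weights over all indices diverges. Equal environments therefore have to be told apart by
  computation. This works because they are measures: lower bounds on the alternatives to a history
  bound its own mass from above, and a difference shows itself at a finite stage. Secondly, entropy
  is not monotone, so lower bounds on its argument give no one-sided bounds on it; only convergence
  without a rate is available, and comparisons of actions cannot be decided outright. The slack
  granted to an action at \<open>h\<close> is proportional to \<open>\<xi> h\<close>: the masses of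
  the histories at one level add up to the mass of their common prefix, so the losses of one level
  do too, and the final division by \<open>\<xi> h\<close> leaves an absolute error. At stage
  \<open>n\<close> a natural number \<open>p\<close> stands for \<open>p / 2 ^ n\<close>, so that
  sums, maxima and comparisons at one stage act on numerators alone.\<close>

definition grec :: "nat \<Rightarrow> (nat list \<Rightarrow> nat) \<Rightarrow> bool" where
  "grec n f \<longleftrightarrow> (\<exists>g. general_recursive n g \<and> (\<forall>xs. length xs = n \<longrightarrow> f xs = g xs))"

text \<open>The inductive predicate speaks of functions on all lists; this closure under agreement
  on lists of length \<open>n\<close> is what allows functions to be rewritten freely in the later
  rules.\<close>

lemma grec_cong: "grec n f \<Longrightarrow> (\<And>xs. length xs = n \<Longrightarrow> f xs = g xs) \<Longrightarrow> grec n g"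
  unfolding grec_def by metis

lemma grec_proj: "i < n \<Longrightarrow> grec n (\<lambda>xs. xs ! i)"
  unfolding grec_def using general_recursive.proj by blast

lemma grec_comp:
  assumes f: "grec (length gs) f" and gs: "\<And>g. g \<in> set gs \<Longrightarrow> grec n g"
  shows "grec n (\<lambda>xs. f (map (\<lambda>g. g xs) gs))"
proof -
  obtain f' where f': "general_recursive (length gs) f'" "\<And>xs. length xs = length gs \<Longrightarrow> f xs = f' xs"
    using f unfolding grec_def by blast
  obtain r where r: "\<And>g. g \<in> set gs \<Longrightarrow> general_recursive n (r g) \<and> (\<forall>xs. length xs = n \<longrightarrow> g xs = r g xs)"
    using gs unfolding grec_def by metis
  have "general_recursive n (\<lambda>xs. f' (map (\<lambda>g. g xs) (map r gs)))"
    by (rule general_recursive.comp) (use f' r in auto)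
  moreover have "f (map (\<lambda>g. g xs) gs) = f' (map (\<lambda>g. g xs) (map r gs))" if "length xs = n" for xs
  proof -
    have "map (\<lambda>g. g xs) gs = map (\<lambda>g. g xs) (map r gs)"
      using r that by auto
    then show ?thesis using f'(2)[of "map (\<lambda>g. g xs) gs"] by (metis length_map)
  qed
  ultimately show ?thesis unfolding grec_def by blast
qed

text \<open>The basic scheme counts along its first argument. Feeding it \<open>h xs # xs\<close>,
  by composition with projections, makes the recursion depth an arbitrary function of arguments that
  all stay available to the step.\<close>

lemma grec_prim_rec:
  assumes f: "grec n f" and h: "grec n h" and g: "grec (Suc (Suc n)) g"
  shows "grec n (\<lambda>xs. rec_nat (f xs) (\<lambda>k r. g (k # r # xs)) (h xs))"
proof -
  obtain f' where f': "general_recursive n f'" "\<And>xs. length xs = n \<Longrightarrow> f xs = f' xs"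
    using f unfolding grec_def by blast
  obtain g' where g': "general_recursive (Suc (Suc n)) g'"
      "\<And>xs. length xs = Suc (Suc n) \<Longrightarrow> g xs = g' xs"
    using g unfolding grec_def by blast
  let ?R = "\<lambda>xs. rec_nat (f' (tl xs)) (\<lambda>k r. g' (k # r # tl xs)) (hd xs)"
  let ?gs = "h # map (\<lambda>i xs. xs ! i) [0..<n]"
  have "grec (length ?gs) ?R"
    using general_recursive.prim_rec[OF f'(1) g'(1)] unfolding grec_def by auto
  then have "grec n (\<lambda>xs. ?R (map (\<lambda>g. g xs) ?gs))"
    by (rule grec_comp) (use h grec_proj in auto)
  then show ?thesis
  proof (rule grec_cong)
    fix xs :: "nat list" assume len: "length xs = n"
    have "map (\<lambda>g. g xs) ?gs = h xs # xs"
      using len by (auto simp: comp_def intro: nth_equalityI)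
    moreover have "rec_nat (f' xs) (\<lambda>k r. g' (k # r # xs)) m = rec_nat (f xs) (\<lambda>k r. g (k # r # xs)) m" for m
      by (induction m) (use len f' g' in auto)
    ultimately show "?R (map (\<lambda>g. g xs) ?gs) = rec_nat (f xs) (\<lambda>k r. g (k # r # xs)) (h xs)"
      by simp
  qed
qed

lemma grec_minimise:
  assumes f: "grec (Suc n) f" and ex: "\<And>xs. length xs = n \<Longrightarrow> \<exists>y. f (y # xs) = 0"
  shows "grec n (\<lambda>xs. LEAST y. f (y # xs) = 0)"
proof -
  obtain f' where f': "general_recursive (Suc n) f'" "\<And>xs. length xs = Suc n \<Longrightarrow> f xs = f' xs"
    using f unfolding grec_def by blast
  have eq: "f (y # xs) = f' (y # xs)" if "length xs = n" for y xs using f'(2) that by simp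
  have "general_recursive n (\<lambda>xs. LEAST y. f' (y # xs) = 0)"
    by (rule general_recursive.minimise[OF f'(1)]) (metis ex eq)
  then show ?thesis unfolding grec_def using eq by auto
qed

lemma grec_apply1:
  assumes F: "grec 1 (\<lambda>xs. F (xs ! 0))" and f: "grec n f"
  shows "grec n (\<lambda>xs. F (f xs))"
  using grec_comp[of "[f]" "\<lambda>xs. F (xs ! 0)" n] assms by simp

lemma grec_apply2:
  assumes F: "grec 2 (\<lambda>xs. F (xs ! 0) (xs ! 1))" and f: "grec n f" and g: "grec n g"
  shows "grec n (\<lambda>xs. F (f xs) (g xs))"
  using grec_comp[of "[f, g]" "\<lambda>xs. F (xs ! 0) (xs ! 1)" n] assms
  by (auto simp: numeral_2_eq_2)

lemma grec_zero: "grec n (\<lambda>xs. 0)"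
  unfolding grec_def using general_recursive.zero by blast

lemma grec_Suc: "grec n f \<Longrightarrow> grec n (\<lambda>xs. Suc (f xs))"
  by (rule grec_apply1[of Suc]) (use general_recursive.succ grec_def in auto)

lemma grec_const: "grec n (\<lambda>xs. c)"
  by (induction c) (auto intro: grec_zero grec_Suc)

lemma grec_rec2:
  assumes "grec 2 f" "grec 4 (\<lambda>xs. g (xs ! 0) (xs ! 1) (xs ! 2) (xs ! 3))"
  shows "grec 2 (\<lambda>xs. rec_nat (f xs) (\<lambda>k r. g k r (xs ! 0) (xs ! 1)) (xs ! 1))"
  using grec_prim_rec[of 2 f "\<lambda>xs. xs ! 1" "\<lambda>xs. g (xs ! 0) (xs ! 1) (xs ! 2) (xs ! 3)"] assms
  by (simp add: grec_proj numeral_eq_Suc)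

lemma grec_add: "grec n f \<Longrightarrow> grec n g \<Longrightarrow> grec n (\<lambda>xs. f xs + g xs)"
proof (rule grec_apply2[of "(+)"])
  have "rec_nat a (\<lambda>k r. Suc r) b = a + b" for a b :: nat by (induction b) auto
  then show "grec 2 (\<lambda>xs. xs ! 0 + xs ! 1)"
    using grec_rec2[of "\<lambda>xs. xs ! 0" "\<lambda>k r a b. Suc r"] by (simp add: grec_proj grec_Suc)
qed

lemma grec_mult: "grec n f \<Longrightarrow> grec n g \<Longrightarrow> grec n (\<lambda>xs. f xs * g xs)"
proof (rule grec_apply2[of "(*)"])
  have "rec_nat 0 (\<lambda>k r. r + a) b = a * b" for a b :: nat by (induction b) auto
  then show "grec 2 (\<lambda>xs. xs ! 0 * xs ! 1)"
    using grec_rec2[of "\<lambda>xs. 0" "\<lambda>k r a b. r + a"] by (simp add: grec_proj grec_add grec_zero)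
qed

lemma grec_diff: "grec n f \<Longrightarrow> grec n g \<Longrightarrow> grec n (\<lambda>xs. f xs - g xs)"
proof (rule grec_apply2[of "(-)"])
  have pred: "grec n (\<lambda>xs. f xs - 1)" if "grec n f" for n f
  proof (rule grec_apply1[of "\<lambda>x. x - 1", OF _ that])
    have "rec_nat 0 (\<lambda>k r. k) b = b - 1" for b :: nat by (cases b) auto
    then show "grec 1 (\<lambda>xs. xs ! 0 - 1)"
      using grec_prim_rec[of 1 "\<lambda>xs. 0" "\<lambda>xs. xs ! 0" "\<lambda>xs. xs ! 0"]
      by (simp add: grec_proj grec_zero)
  qed
  have "rec_nat a (\<lambda>k r. r - 1) b = a - b" for a b :: nat by (induction b) auto
  then show "grec 2 (\<lambda>xs. xs ! 0 - xs ! 1)"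
    using grec_rec2[of "\<lambda>xs. xs ! 0" "\<lambda>k r a b. r - 1"] by (simp add: grec_proj pred[simplified])
qed

lemma grec_triangle: "grec n f \<Longrightarrow> grec n (\<lambda>xs. triangle (f xs))"
proof (rule grec_apply1[of triangle])
  have "rec_nat 0 (\<lambda>k r. r + Suc k) b = triangle b" for b :: nat by (induction b) auto
  then show "grec 1 (\<lambda>xs. triangle (xs ! 0))"
    using grec_prim_rec[of 1 "\<lambda>xs. 0" "\<lambda>xs. xs ! 0" "\<lambda>xs. xs ! 1 + Suc (xs ! 0)"]
    by (simp add: grec_proj grec_zero grec_add grec_Suc del: add_Suc_right)
qed

lemma grec_prod_encode: "grec n f \<Longrightarrow> grec n g \<Longrightarrow> grec n (\<lambda>xs. prod_encode (f xs, g xs))"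
  unfolding prod_encode_def by (simp add: grec_add grec_triangle)

lemma triangle_mono: "a \<le> b \<Longrightarrow> triangle a \<le> triangle b"
  by (induction b) (auto simp: le_Suc_eq)

text \<open>\<open>prod_encode (a, b)\<close> is \<open>triangle (a + b) + a\<close>, which lies
  below the next triangular number. So \<open>a + b\<close> is found by search, and both components
  of a pair can be recovered from it.\<close>

lemma Least_triangle: "(LEAST s. prod_encode (a, b) < triangle (Suc s)) = a + b"
proof (rule Least_equality)
  fix y assume y: "prod_encode (a, b) < triangle (Suc y)"
  show "a + b \<le> y"
  proof (rule ccontr)
    assume "\<not> a + b \<le> y"
    then have "triangle (Suc y) \<le> triangle (a + b)" by (intro triangle_mono) auto
    then show False using y by (simp add: prod_encode_def)
  qed
qed (simp add: prod_encode_def)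

lemma grec_prod_decode:
  assumes "grec n f"
  shows "grec n (\<lambda>xs. fst (prod_decode (f xs)))" "grec n (\<lambda>xs. snd (prod_decode (f xs)))"
proof -
  define s where "s x = (LEAST s. Suc x - triangle (Suc s) = 0)" for x
  have s: "s x = fst (prod_decode x) + snd (prod_decode x)" for x
    using Least_triangle[of "fst (prod_decode x)" "snd (prod_decode x)"]
    by (simp add: s_def Suc_le_eq del: triangle_Suc)
  have gs: "grec n (\<lambda>xs. s (f xs))" if "grec n f" for f n
  proof (rule grec_apply1[of s, OF _ that])
    have ex: "\<exists>y. Suc x - triangle (Suc y) = 0" for x :: nat by (rule exI[of _ x]) simp
    show "grec 1 (\<lambda>xs. s (xs ! 0))"
      unfolding s_def
      using grec_minimise[of 1 "\<lambda>xs. Suc (xs ! 1) - triangle (Suc (xs ! 0))"] ex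
      by (simp add: grec_diff grec_Suc grec_triangle grec_proj del: triangle_Suc)
  qed
  have x: "x = triangle (s x) + fst (prod_decode x)" for x
    unfolding s using prod_decode_inverse[of x]
    by (metis (no_types, lifting) case_prod_conv prod.collapse prod_encode_def)
  have f: "fst (prod_decode x) = x - triangle (s x)" for x using x[of x] by simp
  have g: "snd (prod_decode x) = s x - (x - triangle (s x))" for x using s[of x] f[of x] by simp
  show "grec n (\<lambda>xs. fst (prod_decode (f xs)))" unfolding f
    by (intro grec_diff grec_triangle gs assms)
  show "grec n (\<lambda>xs. snd (prod_decode (f xs)))" unfolding g
    by (intro grec_diff grec_triangle gs assms)
qed

section \<open>Closure properties of unary computable functions and of predicates\<close>

named_theorems computable_intros

lemma computable_fun_iff_grec: "computable_fun f \<longleftrightarrow> grec 1 (\<lambda>xs. f (xs ! 0))"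
proof
  assume "computable_fun f"
  then obtain g where g: "general_recursive 1 g" "\<And>x. f x = g [x]" unfolding computable_fun_def by blast
  have "f (xs ! 0) = g xs" if "length xs = 1" for xs
    using that g(2) by (cases xs) auto
  then show "grec 1 (\<lambda>xs. f (xs ! 0))" unfolding grec_def using g(1) by blast
next
  assume "grec 1 (\<lambda>xs. f (xs ! 0))"
  then show "computable_fun f" unfolding grec_def computable_fun_def
    by (metis One_nat_def length_Cons list.size(3) nth_Cons_0)
qed

lemma computable_fun_compose:
  "computable_fun F \<Longrightarrow> computable_fun f \<Longrightarrow> computable_fun (\<lambda>x. F (f x))"
  unfolding computable_fun_iff_grec by (rule grec_apply1)

lemma computable_fun_const [computable_intros]: "computable_fun (\<lambda>x. c)"
  unfolding computable_fun_iff_grec by (rule grec_const)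

lemma computable_fun_id [computable_intros]: "computable_fun (\<lambda>x. x)"
  unfolding computable_fun_iff_grec by (simp add: grec_proj)

lemma computable_fun_Suc [computable_intros]: "computable_fun f \<Longrightarrow> computable_fun (\<lambda>x. Suc (f x))"
  unfolding computable_fun_iff_grec by (rule grec_Suc)

lemma computable_fun_arith [computable_intros]:
  assumes "computable_fun f" "computable_fun g"
  shows "computable_fun (\<lambda>x. f x + g x)" "computable_fun (\<lambda>x. f x * g x)"
    "computable_fun (\<lambda>x. f x - g x)" "computable_fun (\<lambda>x. prod_encode (f x, g x))"
  using assms unfolding computable_fun_iff_grec
  by (simp_all add: grec_add grec_mult grec_diff grec_prod_encode)

lemma computable_fun_prod_decode [computable_intros]:
  assumes "computable_fun f"
  shows "computable_fun (\<lambda>x. fst (prod_decode (f x)))" "computable_fun (\<lambda>x. snd (prod_decode (f x)))"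
  using assms unfolding computable_fun_iff_grec by (simp_all add: grec_prod_decode)

text \<open>Further arguments are packed into one by pairing. Every rule then concerns a single
  variable, bound variables become components of it, and computability proofs follow the syntax of
  the term.\<close>

definition computable_fun2 :: "(nat \<Rightarrow> nat \<Rightarrow> nat) \<Rightarrow> bool" where
  "computable_fun2 F \<longleftrightarrow> computable_fun (\<lambda>x. F (fst (prod_decode x)) (snd (prod_decode x)))"

definition computable_fun3 :: "(nat \<Rightarrow> nat \<Rightarrow> nat \<Rightarrow> nat) \<Rightarrow> bool" where
  "computable_fun3 F \<longleftrightarrow> computable_fun (\<lambda>x. F (fst (prod_decode x))
     (fst (prod_decode (snd (prod_decode x)))) (snd (prod_decode (snd (prod_decode x)))))"

lemmas computable_fun2I [computable_intros] = computable_fun2_def[THEN iffD2]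
lemmas computable_fun3I [computable_intros] = computable_fun3_def[THEN iffD2]

lemma computable_fun2_compose:
  assumes "computable_fun2 F" "computable_fun f" "computable_fun g"
  shows "computable_fun (\<lambda>x. F (f x) (g x))"
  using computable_fun_compose[OF assms(1)[unfolded computable_fun2_def]
      computable_fun_arith(4)[OF assms(2,3)]] by simp

lemma computable_fun3_compose:
  assumes "computable_fun3 F" "computable_fun f" "computable_fun g" "computable_fun h"
  shows "computable_fun (\<lambda>x. F (f x) (g x) (h x))"
  using computable_fun_compose[OF assms(1)[unfolded computable_fun3_def]
      computable_fun_arith(4)[OF assms(2) computable_fun_arith(4)[OF assms(3,4)]]] by simp

lemma computable_fun_rec_nat [computable_intros]:
  assumes f: "computable_fun f" and h: "computable_fun h" and g: "computable_fun3 g"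
  shows "computable_fun (\<lambda>x. rec_nat (f x) (g x) (h x))"
proof -
  let ?g = "\<lambda>x. g (fst (prod_decode x))
     (fst (prod_decode (snd (prod_decode x)))) (snd (prod_decode (snd (prod_decode x))))"
  have "grec (Suc (Suc 1)) (\<lambda>xs. ?g (prod_encode (xs ! 2, prod_encode (xs ! 0, xs ! 1))))"
    by (rule grec_apply1[of ?g]) (use g in \<open>auto simp: computable_fun3_def computable_fun_iff_grec
        intro!: grec_prod_encode grec_proj\<close>)
  from grec_prim_rec[OF f[unfolded computable_fun_iff_grec] h[unfolded computable_fun_iff_grec] this]
  show ?thesis unfolding computable_fun_iff_grec by simp
qed

text \<open>Truth is the value 0, in agreement with \<open>computable_rel\<close> and with
  minimisation.\<close>

definition computable_pred :: "(nat \<Rightarrow> bool) \<Rightarrow> bool" where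
  "computable_pred P \<longleftrightarrow> computable_fun (\<lambda>x. if P x then 0 else 1)"

definition computable_pred2 :: "(nat \<Rightarrow> nat \<Rightarrow> bool) \<Rightarrow> bool" where
  "computable_pred2 P \<longleftrightarrow> computable_pred (\<lambda>x. P (fst (prod_decode x)) (snd (prod_decode x)))"

lemmas computable_pred2I [computable_intros] = computable_pred2_def[THEN iffD2]

lemma computable_pred_compose:
  "computable_pred F \<Longrightarrow> computable_fun f \<Longrightarrow> computable_pred (\<lambda>x. F (f x))"
  unfolding computable_pred_def by (rule computable_fun_compose)

lemma computable_pred2_compose:
  assumes "computable_pred2 F" "computable_fun f" "computable_fun g"
  shows "computable_pred (\<lambda>x. F (f x) (g x))"
  using computable_pred_compose[OF assms(1)[unfolded computable_pred2_def]
      computable_fun_arith(4)[OF assms(2,3)]] by simp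

lemma computable_pred_eq_0: "computable_fun f \<Longrightarrow> computable_pred (\<lambda>x. f x = 0)"
proof -
  assume f: "computable_fun f"
  have "computable_fun (\<lambda>x. 1 - (1 - f x))" by (intro computable_intros f)
  moreover have "(\<lambda>x. 1 - (1 - f x)) = (\<lambda>x. if f x = 0 then 0 else 1)" by auto
  ultimately show ?thesis unfolding computable_pred_def by simp
qed

lemma computable_pred_const [computable_intros]: "computable_pred (\<lambda>x. c)"
  unfolding computable_pred_def by (rule computable_fun_const)

lemma computable_pred_connectives [computable_intros]:
  assumes P: "computable_pred P" and Q: "computable_pred Q"
  shows "computable_pred (\<lambda>x. P x \<and> Q x)" "computable_pred (\<lambda>x. P x \<or> Q x)"
    "computable_pred (\<lambda>x. P x \<longrightarrow> Q x)"
proof -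
  let ?p = "\<lambda>x. if P x then 0 else 1 :: nat" and ?q = "\<lambda>x. if Q x then 0 else 1 :: nat"
  have p: "computable_fun ?p" and q: "computable_fun ?q" using P Q unfolding computable_pred_def .
  have "computable_pred (\<lambda>x. ?p x + ?q x = 0)" "computable_pred (\<lambda>x. ?p x * ?q x = 0)"
    "computable_pred (\<lambda>x. (1 - ?p x) * ?q x = 0)"
    by (intro computable_pred_eq_0 computable_intros p q)+
  moreover have "(\<lambda>x. ?p x + ?q x = 0) = (\<lambda>x. P x \<and> Q x)" "(\<lambda>x. ?p x * ?q x = 0) = (\<lambda>x. P x \<or> Q x)"
    "(\<lambda>x. (1 - ?p x) * ?q x = 0) = (\<lambda>x. P x \<longrightarrow> Q x)"
    by auto
  ultimately show "computable_pred (\<lambda>x. P x \<and> Q x)" "computable_pred (\<lambda>x. P x \<or> Q x)"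
    "computable_pred (\<lambda>x. P x \<longrightarrow> Q x)"
    by simp_all
qed

lemma computable_pred_not [computable_intros]:
  assumes "computable_pred P" shows "computable_pred (\<lambda>x. \<not> P x)"
  using computable_pred_connectives(3)[OF assms computable_pred_const[of False]] by simp

lemma computable_pred_order [computable_intros]:
  assumes "computable_fun f" "computable_fun g"
  shows "computable_pred (\<lambda>x. f x \<le> g x)" "computable_pred (\<lambda>x. f x < g x)"
    "computable_pred (\<lambda>x. f x = g x)"
proof -
  have le: "computable_pred (\<lambda>x. f x \<le> g x)" if "computable_fun f" "computable_fun g" for f g
    using computable_pred_eq_0[OF computable_fun_arith(3)[OF that]] by simp
  show "computable_pred (\<lambda>x. f x \<le> g x)" by (intro le assms)
  show "computable_pred (\<lambda>x. f x < g x)"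
    using computable_pred_not[OF le[OF assms(2,1)]] by (simp add: not_le)
  show "computable_pred (\<lambda>x. f x = g x)"
    using computable_pred_connectives(1)[OF le[OF assms(1,2)] le[OF assms(2,1)]] by (simp add: eq_iff)
qed

lemma computable_fun_if [computable_intros]:
  assumes P: "computable_pred P" and f: "computable_fun f" and g: "computable_fun g"
  shows "computable_fun (\<lambda>x. if P x then f x else g x)"
proof -
  let ?p = "\<lambda>x. if P x then 0 else 1 :: nat"
  have p: "computable_fun ?p" using P unfolding computable_pred_def .
  have "computable_fun (\<lambda>x. (1 - ?p x) * f x + ?p x * g x)"
    by (intro computable_intros p f g)
  moreover have "(\<lambda>x. (1 - ?p x) * f x + ?p x * g x) = (\<lambda>x. if P x then f x else g x)" by auto
  ultimately show ?thesis by simp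
qed

lemma computable_pred_ball [computable_intros]:
  assumes f: "computable_fun f" and P: "computable_pred2 P"
  shows "computable_pred (\<lambda>x. \<forall>k<f x. P x k)"
proof -
  have "computable_pred (\<lambda>x. rec_nat (0::nat) (\<lambda>k r. r + (if P x k then 0 else 1)) (f x) = 0)"
    by (intro computable_intros computable_pred2_compose[OF P] f)
  moreover have "rec_nat (0::nat) (\<lambda>k r. r + (if P x k then 0 else 1)) n = 0 \<longleftrightarrow> (\<forall>k<n. P x k)" for n x
    by (induction n) (auto simp: less_Suc_eq)
  ultimately show ?thesis by simp
qed

lemma computable_pred_bex [computable_intros]:
  assumes f: "computable_fun f" and P: "computable_pred2 P"
  shows "computable_pred (\<lambda>x. \<exists>k<f x. P x k)"
proof -
  have "computable_pred (\<lambda>x. \<not> (\<forall>k<f x. \<not> P x k))"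
    by (intro computable_intros computable_pred2_compose[OF P] f)
  then show ?thesis by simp
qed

lemma computable_fun_Least [computable_intros]:
  assumes P: "computable_pred2 P" and ex: "\<And>x. \<exists>y. P x y"
  shows "computable_fun (\<lambda>x. LEAST y. P x y)"
proof -
  let ?P = "\<lambda>z. if P (fst (prod_decode z)) (snd (prod_decode z)) then 0 else 1 :: nat"
  have "grec (Suc 1) (\<lambda>xs. ?P (prod_encode (xs ! 1, xs ! 0)))"
    by (rule grec_apply1[of ?P]) (use P in \<open>auto simp: computable_pred2_def computable_pred_def
        computable_fun_iff_grec intro!: grec_prod_encode grec_proj\<close>)
  moreover have "?P (prod_encode ((y # xs) ! 1, (y # xs) ! 0)) = 0 \<longleftrightarrow> P (xs ! 0) y" for y xs by simp
  ultimately show ?thesis unfolding computable_fun_iff_grec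
    using grec_minimise[of 1 "\<lambda>xs. ?P (prod_encode (xs ! 1, xs ! 0))"] ex by simp
qed

section \<open>Recursion on coded lists and trees\<close>

lemma computable_fun_power [computable_intros]:
  assumes "computable_fun f" "computable_fun g"
  shows "computable_fun (\<lambda>x. f x ^ g x)"
proof -
  have "rec_nat 1 (\<lambda>_ r. r * a) n = a ^ n" for a n :: nat by (induction n) auto
  moreover have "computable_fun (\<lambda>x. rec_nat 1 (\<lambda>_ r. r * f x) (g x))"
    by (intro computable_intros assms computable_fun_compose[OF assms(1)])
  ultimately show ?thesis by simp
qed

lemma div_Suc_eq_Least: "a div Suc b = (LEAST q. a < Suc q * Suc b)"
proof (rule Least_equality[symmetric])
  show "a < Suc (a div Suc b) * Suc b"
    by (metis dividend_less_div_times mult_Suc zero_less_Suc add.commute)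
  show "a div Suc b \<le> q" if "a < Suc q * Suc b" for q
    using that less_mult_imp_div_less less_Suc_eq_le by blast
qed

lemma computable_fun_div_Suc [computable_intros]:
  assumes "computable_fun f" "computable_fun g"
  shows "computable_fun (\<lambda>x. f x div Suc (g x))"
  unfolding div_Suc_eq_Least
proof (rule computable_fun_Least)
  show "computable_pred2 (\<lambda>x q. f x < Suc q * Suc (g x))"
    by (intro computable_intros computable_fun_compose[OF assms(1)] computable_fun_compose[OF assms(2)])
  show "\<exists>q. f x < Suc q * Suc (g x)" for x by (rule exI[of _ "f x"]) simp
qed

lemma computable_fun_sum [computable_intros]:
  assumes "computable_fun h" "computable_fun2 F"
  shows "computable_fun (\<lambda>x. \<Sum>k<h x. F x k)"
proof -
  have "rec_nat 0 (\<lambda>k r. r + F x k) n = (\<Sum>k<n. F x k)" for x n by (induction n) auto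
  moreover have "computable_fun (\<lambda>x. rec_nat 0 (\<lambda>k r. r + F x k) (h x))"
    by (intro computable_intros assms computable_fun2_compose[OF assms(2)])
  ultimately show ?thesis by simp
qed

lemma computable_fun_max [computable_intros]:
  assumes "computable_fun f" "computable_fun g"
  shows "computable_fun (\<lambda>x. max (f x) (g x))" "computable_fun (\<lambda>x. min (f x) (g x))"
  unfolding max_def min_def by (intro computable_intros assms)+

lemma computable_fun_Max [computable_intros]:
  assumes "computable_fun h" "computable_fun2 F"
  shows "computable_fun (\<lambda>x. Max (F x ` {..h x}))"
proof -
  have "rec_nat (F x 0) (\<lambda>k r. max (F x (Suc k)) r) n = Max (F x ` {..n})" for x n
    by (induction n) (auto simp: atMost_Suc)
  moreover have "computable_fun (\<lambda>x. rec_nat (F x 0) (\<lambda>k r. max (F x (Suc k)) r) (h x))"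
    by (intro computable_intros assms computable_fun2_compose[OF assms(2)])
  ultimately show ?thesis by simp
qed

lemma computable_fun_sum_finite [computable_intros]:
  assumes "\<And>i. computable_fun (\<lambda>x. F x i)"
  shows "computable_fun (\<lambda>x. \<Sum>i\<in>(S :: 'i set). F x i)"
proof (induction S rule: infinite_finite_induct)
  case (insert i S)
  then show ?case by (simp add: computable_fun_arith assms)
qed (simp_all add: computable_fun_const)

lemma computable_fun_Max_finite [computable_intros]:
  assumes "\<And>i. computable_fun (\<lambda>x. F x i)"
  shows "computable_fun (\<lambda>x. Max (range (\<lambda>i::'i::finite. F x i)))"
proof -
  have "computable_fun (\<lambda>x. Max (F x ` S))" if "finite S" "S \<noteq> {}" for S :: "'i set"
    using that
  proof (induction rule: finite_ne_induct)
    case (insert i S)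
    then show ?case by (simp add: computable_fun_max assms)
  qed (simp add: assms)
  then show ?thesis by simp
qed

lemma computable_pred_finite [computable_intros]:
  assumes "\<And>i. computable_pred (\<lambda>x. P x i)"
  shows "computable_pred (\<lambda>x. \<forall>i::'i::finite. P x i)"
    "computable_pred (\<lambda>x. \<exists>i::'i::finite. P x i)"
proof -
  have "computable_pred (\<lambda>x. \<forall>i\<in>S. P x i)" "computable_pred (\<lambda>x. \<exists>i\<in>S. P x i)" if "finite S" for S :: "'i set"
    using that
    by (induction; simp add: computable_pred_const computable_pred_connectives assms)+
  from this[of UNIV] show "computable_pred (\<lambda>x. \<forall>i::'i::finite. P x i)"
    "computable_pred (\<lambda>x. \<exists>i::'i::finite. P x i)" by simp_all
qed

text \<open>A nonempty list has the code \<open>Suc (prod_encode (x, c))\<close> with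
  \<open>c\<close> the code of its tail, so subtracting 1 and projecting removes the head. The code
  0 of the empty list is a fixed point, which makes dropping too many entries harmless.\<close>

lemma list_encode_drop: "rec_nat c (\<lambda>_ r. snd (prod_decode (r - 1))) i = list_encode (drop i (list_decode c))"
proof (induction i)
  case (Suc i)
  have *: "snd (prod_decode (list_encode l - 1)) = list_encode (tl l)" for l
  proof (cases l)
    case Nil
    have "prod_decode 0 = (0, 0)" by (simp add: prod_decode_def prod_decode_aux.simps)
    then show ?thesis using Nil by simp
  qed simp
  show ?case using Suc * by (simp add: drop_Suc tl_drop[symmetric] del: One_nat_def)
qed simp

lemma computable_fun_drop:
  assumes "computable_fun f" "computable_fun g"
  shows "computable_fun (\<lambda>x. list_encode (drop (g x) (list_decode (f x))))"
  unfolding list_encode_drop[symmetric] by (intro computable_intros assms)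

lemma list_encode_eq_0_iff: "list_encode l = 0 \<longleftrightarrow> l = []"
  by (cases l) auto

lemma computable_fun_length [computable_intros]:
  assumes "computable_fun f"
  shows "computable_fun (\<lambda>x. length (list_decode (f x)))"
proof -
  have "length l = (LEAST j. list_encode (drop j l) = 0)" for l
    by (rule Least_equality[symmetric]) (auto simp: list_encode_eq_0_iff)
  moreover have "computable_fun (\<lambda>x. LEAST j. list_encode (drop j (list_decode (f x))) = 0)"
  proof (rule computable_fun_Least)
    show "\<exists>j. list_encode (drop j (list_decode (f x))) = 0" for x
      by (rule exI[of _ "length (list_decode (f x))"]) simp
  qed (intro computable_intros computable_fun_drop computable_fun_compose[OF assms])
  ultimately show ?thesis by simp
qed

definition nth_code :: "nat \<Rightarrow> nat \<Rightarrow> nat" where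
  "nth_code c i = (if i < length (list_decode c) then list_decode c ! i else 0)"

lemma computable_fun_nth [computable_intros]:
  assumes "computable_fun f" "computable_fun g"
  shows "computable_fun (\<lambda>x. nth_code (f x) (g x))"
proof -
  have "fst (prod_decode (list_encode (drop i l) - 1)) = l ! i" if "i < length l" for i l
    using that by (simp add: Cons_nth_drop_Suc[symmetric])
  then have "nth_code (f x) (g x) = (if g x < length (list_decode (f x))
      then fst (prod_decode (list_encode (drop (g x) (list_decode (f x))) - 1)) else 0)" for x
    by (simp add: nth_code_def)
  then show ?thesis
    by simp (intro computable_intros computable_fun_drop assms)
qed

lemma computable_fun_tabulate [computable_intros]:
  assumes "computable_fun h" "computable_fun2 F"
  shows "computable_fun (\<lambda>x. list_encode (map (F x) [0..<h x]))"
proof -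
  \<comment> \<open>Codes grow at the front, so the table is built from its last entry backwards:
    stage \<open>j\<close> holds the last \<open>j\<close> entries.\<close>
  have "j \<le> n \<Longrightarrow> rec_nat 0 (\<lambda>j r. Suc (prod_encode (F x (n - Suc j), r))) j
    = list_encode (map (F x) [n - j..<n])" for x n j
  proof (induction j)
    case (Suc j)
    have "[n - Suc j..<n] = (n - Suc j) # [n - j..<n]"
      using Suc.prems by (subst upt_conv_Cons) (auto simp: Suc_diff_Suc)
    then show ?case using Suc by simp
  qed simp
  from this[OF order_refl]
  have "list_encode (map (F x) [0..<h x]) = rec_nat 0 (\<lambda>j r. Suc (prod_encode (F x (h x - Suc j), r))) (h x)" for x
    by simp
  moreover have "computable_fun (\<lambda>x. rec_nat 0 (\<lambda>j r. Suc (prod_encode (F x (h x - Suc j), r))) (h x))"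
    by (intro computable_intros assms computable_fun_compose[OF assms(1)] computable_fun2_compose[OF assms(2)])
  ultimately show ?thesis by simp
qed

lemma nth_code_tabulate: "i < n \<Longrightarrow> nth_code (list_encode (map f [0..<n])) i = f i"
  by (simp add: nth_code_def)

lemma computable_fun_snoc [computable_intros]:
  assumes "computable_fun f" "computable_fun g"
  shows "computable_fun (\<lambda>x. list_encode (list_decode (f x) @ [g x]))"
proof -
  have "l @ [y] = map (\<lambda>i. if i < length l then nth_code (list_encode l) i else y) [0..<Suc (length l)]" for l y
    by (rule nth_equalityI) (auto simp: nth_code_def nth_append simp del: upt_Suc)
  from this[of "list_decode c" for c]
  have "list_encode (list_decode (f x) @ [g x]) = list_encode (map (\<lambda>i. if i < length (list_decode (f x))
     then nth_code (f x) i else g x) [0..<Suc (length (list_decode (f x)))])" for x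
    by (simp del: upt_Suc cong: if_cong)
  then show ?thesis
    by (simp del: upt_Suc)
      (intro computable_intros assms computable_fun_compose[OF assms(1)] computable_fun_compose[OF assms(2)])
qed

lemma computable_fun_take:
  assumes "computable_fun f" "computable_fun g"
  shows "computable_fun (\<lambda>x. list_encode (take (g x) (list_decode (f x))))"
proof -
  have "take n l = map (nth_code (list_encode l)) [0..<min n (length l)]" for n l
    by (rule nth_equalityI) (auto simp: nth_code_def)
  from this[of _ "list_decode c" for c]
  have "list_encode (take (g x) (list_decode (f x))) =
      list_encode (map (nth_code (f x)) [0..<min (g x) (length (list_decode (f x)))])" for x
    by simp
  then show ?thesis
    by simp (intro computable_intros assms computable_fun_compose[OF assms(1)])
qed

lemma computable_fun_take_snoc [computable_intros]:
  assumes "computable_fun f" "computable_fun g" "computable_fun h"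
  shows "computable_fun (\<lambda>x. list_encode (take (g x) (list_decode (f x)) @ [h x]))"
  using computable_fun_snoc[OF computable_fun_take[OF assms(1,2)] assms(3)] by simp

text \<open>Backward induction on numerators and codes, the integer counterpart of
  \<open>opt_sum\<close>: maximum over actions, sum over percepts, with \<open>s a e\<close> giving
  the code of the successor.\<close>

primrec tree_value :: "(nat \<Rightarrow> nat) \<Rightarrow> ('a::finite \<Rightarrow> 'e::finite \<Rightarrow> nat \<Rightarrow> nat) \<Rightarrow> nat \<Rightarrow> nat \<Rightarrow> nat" where
  "tree_value G s 0 x = G x"
| "tree_value G s (Suc d) x = Max (range (\<lambda>a. \<Sum>e\<in>UNIV. tree_value G s d (s a e x)))"

text \<open>
  Every node of the tree of depth \<open>d\<close> below \<open>x\<close> is smaller than a computable bound \<open>N\<close>, so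
  the recursion runs on tables of the values at all arguments below \<open>N\<close>.
\<close>

lemma computable_fun_tree_value:
  fixes s :: "'a::finite \<Rightarrow> 'e::finite \<Rightarrow> nat \<Rightarrow> nat"
  assumes G: "computable_fun2 G" and s: "\<And>a e. computable_fun (s a e)"
  shows "computable_fun3 (\<lambda>p d x. tree_value (G p) s d x)"
proof -
  \<comment> \<open>Each round raises the bound by all successors of all numbers below it, so
    successors of numbers below one bound lie below the next.\<close>
  define B where "B x d = rec_nat (Suc x) (\<lambda>_ b. b + (\<Sum>y<b. \<Sum>a\<in>UNIV. \<Sum>e\<in>UNIV. Suc (s a e y))) d" for x d
  define T where "T p N d = rec_nat (list_encode (map (G p) [0..<N]))
    (\<lambda>_ t. list_encode (map (\<lambda>x. Max (range (\<lambda>a. \<Sum>e\<in>UNIV. nth_code t (s a e x)))) [0..<N])) d" for p N d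
  have BSuc: "B x (Suc d) = B x d + (\<Sum>y<B x d. \<Sum>a\<in>UNIV. \<Sum>e\<in>UNIV. Suc (s a e y))" for x d
    by (simp add: B_def)
  have Bmono: "i \<le> j \<Longrightarrow> B x i \<le> B x j" for x i j
    by (rule lift_Suc_mono_le[of "B x"]) (simp_all add: BSuc)
  have Bstep: "s a e y < B x (Suc d)" if "y < B x d" for a e y x d
  proof -
    have "Suc (s a e y) \<le> (\<Sum>e\<in>UNIV. Suc (s a e y))" by (rule member_le_sum) auto
    also have "\<dots> \<le> (\<Sum>a\<in>UNIV. \<Sum>e\<in>UNIV. Suc (s a e y))"
      by (rule member_le_sum[where f = "\<lambda>a. \<Sum>e\<in>UNIV. Suc (s a e y)"]) auto
    also have "\<dots> \<le> (\<Sum>y<B x d. \<Sum>a\<in>UNIV. \<Sum>e\<in>UNIV. Suc (s a e y))"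
      by (rule member_le_sum[where f = "\<lambda>y. \<Sum>a\<in>UNIV. \<Sum>e\<in>UNIV. Suc (s a e y)"]) (use that in auto)
    finally show ?thesis by (simp add: BSuc)
  qed
  \<comment> \<open>The region of correct entries shrinks with \<open>j\<close>, since entries near
    the edge refer to successors outside the table and read the default 0. The root \<open>x\<close>
    is still covered at \<open>j = d\<close>, because \<open>B x 0 = Suc x\<close>.\<close>
  have T: "j \<le> d \<Longrightarrow> y < B x (d - j) \<Longrightarrow> nth_code (T p (B x d) j) y = tree_value (G p) s j y" for p x d j y
  proof (induction j arbitrary: y)
    case 0
    then show ?case by (simp add: T_def nth_code_tabulate)
  next
    case (Suc j)
    have "s a e y < B x (d - j)" for a e
      using Bstep[OF Suc.prems(2), of a e] Suc.prems(1) by (simp add: Suc_diff_Suc)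
    then have IH: "nth_code (T p (B x d) j) (s a e y) = tree_value (G p) s j (s a e y)" for a e
      using Suc by auto
    have "y < B x d" using Suc.prems Bmono[of "d - Suc j" d x] by linarith
    then have "nth_code (T p (B x d) (Suc j)) y =
        Max (range (\<lambda>a. \<Sum>e\<in>UNIV. nth_code (T p (B x d) j) (s a e y)))"
      by (simp add: T_def nth_code_tabulate)
    then show ?case by (simp add: IH)
  qed
  have "tree_value (G p) s d x = nth_code (T p (B x d) d) x" for p d x
    using T[of d d x x p] by (simp add: B_def)
  moreover have "computable_fun3 (\<lambda>p d x. nth_code (T p (B x d) d) x)"
    unfolding T_def B_def
    by (intro computable_intros computable_fun2_compose[OF G] computable_fun_compose[OF s])
  ultimately show ?thesis by simp
qed

section \<open>Least witnesses in the arithmetical hierarchy\<close>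

definition computable_pred3 :: "(nat \<Rightarrow> nat \<Rightarrow> nat \<Rightarrow> bool) \<Rightarrow> bool" where
  "computable_pred3 P \<longleftrightarrow> computable_pred2 (\<lambda>x y. P x (fst (prod_decode y)) (snd (prod_decode y)))"

definition computable_pred4 :: "(nat \<Rightarrow> nat \<Rightarrow> nat \<Rightarrow> nat \<Rightarrow> bool) \<Rightarrow> bool" where
  "computable_pred4 P \<longleftrightarrow> computable_pred3 (\<lambda>x y z. P x y (fst (prod_decode z)) (snd (prod_decode z)))"

lemmas computable_pred3I [computable_intros] = computable_pred3_def[THEN iffD2]
lemmas computable_pred4I [computable_intros] = computable_pred4_def[THEN iffD2]

lemma computable_pred3_compose:
  assumes "computable_pred3 P" "computable_fun f" "computable_fun g" "computable_fun h"
  shows "computable_pred (\<lambda>x. P (f x) (g x) (h x))"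
  using computable_pred2_compose[OF assms(1)[unfolded computable_pred3_def] assms(2)
      computable_fun_arith(4)[OF assms(3,4)]] by simp

lemma computable_pred4_compose:
  assumes "computable_pred4 P" "computable_fun f" "computable_fun g" "computable_fun h" "computable_fun i"
  shows "computable_pred (\<lambda>x. P (f x) (g x) (h x) (i x))"
  using computable_pred3_compose[OF assms(1)[unfolded computable_pred4_def] assms(2,3)
      computable_fun_arith(4)[OF assms(4,5)]] by simp

lemma grec_computable_pred:
  assumes "computable_pred P" "grec n f"
  shows "grec n (\<lambda>xs. if P (f xs) then 0 else 1)"
  using assms(1) unfolding computable_pred_def computable_fun_iff_grec by (rule grec_apply1) fact

lemma computable_relI:
  assumes P: "computable_pred P" and f: "grec n f" and R: "\<And>xs. length xs = n \<Longrightarrow> R xs \<longleftrightarrow> P (f xs)"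
  shows "computable_rel n R"
proof -
  obtain g where g: "general_recursive n g"
      "\<And>xs. length xs = n \<Longrightarrow> (if P (f xs) then 0 else 1) = g xs"
    using grec_computable_pred[OF P f] unfolding grec_def by blast
  have "R xs \<longleftrightarrow> g xs = 0" if "length xs = n" for xs
    using g(2)[OF that] R[OF that] by (auto split: if_splits)
  then show ?thesis unfolding computable_rel_def using g(1) by blast
qed

lemma sigma0_2I:
  assumes P: "computable_pred3 P" and A: "\<And>z. z \<in> A \<longleftrightarrow> (\<exists>k. \<forall>l. P z k l)"
  shows "sigma0 2 A"
proof -
  have "computable_rel (Suc 2) (\<lambda>xs. P (xs ! 0) (xs ! 1) (xs ! 2))"
    by (rule computable_relI[of "\<lambda>x. P (fst (prod_decode x)) (fst (prod_decode (snd (prod_decode x))))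
          (snd (prod_decode (snd (prod_decode x))))" _
          "\<lambda>xs. prod_encode (xs ! 0, prod_encode (xs ! 1, xs ! 2))"])
      (use P in \<open>auto simp: computable_pred3_def computable_pred2_def intro!: grec_prod_encode grec_proj\<close>)
  moreover have "z \<in> A \<longleftrightarrow> alternating True 2 (\<lambda>xs. P (xs ! 0) (xs ! 1) (xs ! 2)) [z]" for z
    unfolding A by (simp add: numeral_2_eq_2)
  ultimately show ?thesis unfolding sigma0_def by blast
qed

lemma sigma0_3I:
  assumes P: "computable_pred4 P" and A: "\<And>z. z \<in> A \<longleftrightarrow> (\<exists>k. \<forall>l. \<exists>m. P z k l m)"
  shows "sigma0 3 A"
proof -
  have "computable_rel (Suc 3) (\<lambda>xs. P (xs ! 0) (xs ! 1) (xs ! 2) (xs ! 3))"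
    by (rule computable_relI[of "\<lambda>x. P (fst (prod_decode x)) (fst (prod_decode (snd (prod_decode x))))
          (fst (prod_decode (snd (prod_decode (snd (prod_decode x))))))
          (snd (prod_decode (snd (prod_decode (snd (prod_decode x))))))" _
          "\<lambda>xs. prod_encode (xs ! 0, prod_encode (xs ! 1, prod_encode (xs ! 2, xs ! 3)))"])
      (use P in \<open>auto simp: computable_pred4_def computable_pred3_def computable_pred2_def
         intro!: grec_prod_encode grec_proj\<close>)
  moreover have "z \<in> A \<longleftrightarrow> alternating True 3 (\<lambda>xs. P (xs ! 0) (xs ! 1) (xs ! 2) (xs ! 3)) [z]" for z
    unfolding A by (simp add: numeral_3_eq_3 numeral_2_eq_2)
  ultimately show ?thesis unfolding sigma0_def by blast
qed

lemma alternating_not: "alternating (\<not> b) n R xs \<longleftrightarrow> \<not> alternating b n (\<lambda>xs. \<not> R xs) xs"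
  by (induction b n "\<lambda>xs. \<not> R xs" xs rule: alternating.induct) auto

lemma computable_rel_not: "computable_rel n R \<Longrightarrow> computable_rel n (\<lambda>xs. \<not> R xs)"
proof -
  assume "computable_rel n R"
  then obtain f where f: "general_recursive n f" "\<And>xs. length xs = n \<Longrightarrow> R xs \<longleftrightarrow> f xs = 0"
    unfolding computable_rel_def by blast
  show ?thesis
    by (rule computable_relI[of "\<lambda>x. x \<noteq> 0" _ f]) (use f in \<open>auto simp: grec_def intro!: computable_intros\<close>)
qed

lemma pi0_if_sigma0_Compl:
  assumes "sigma0 n (- A)" shows "pi0 n A"
proof -
  obtain R where R: "computable_rel (Suc n) R" "\<And>x. x \<in> - A \<longleftrightarrow> alternating True n R [x]"
    using assms unfolding sigma0_def by blast
  have "x \<in> A \<longleftrightarrow> alternating False n (\<lambda>xs. \<not> R xs) [x]" for x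
    using R(2)[of x] alternating_not[of True n "\<lambda>xs. \<not> R xs" "[x]"] by auto
  then show ?thesis unfolding pi0_def using computable_rel_not[OF R(1)] by blast
qed

lemma ex_prod_decode: "(\<exists>x y. Q x y) \<longleftrightarrow> (\<exists>k. Q (fst (prod_decode k)) (snd (prod_decode k)))"
  by (metis fst_conv snd_conv prod_encode_inverse)

lemma all_prod_decode: "(\<forall>x y. Q x y) \<longleftrightarrow> (\<forall>k. Q (fst (prod_decode k)) (snd (prod_decode k)))"
  by (metis fst_conv snd_conv prod_encode_inverse)

text \<open>A finite choice function is coded as a list, so a bounded universal quantifier does not
  raise the complexity of an existential one.\<close>

lemma choice_code: "(\<forall>y<b. \<exists>u. Q y u) \<longleftrightarrow> (\<exists>c. \<forall>y<b. Q y (nth_code c y))" for b :: nat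
proof
  assume "\<forall>y<b. \<exists>u. Q y u"
  then obtain u where u: "\<And>y. y < b \<Longrightarrow> Q y (u y)" by metis
  show "\<exists>c. \<forall>y<b. Q y (nth_code c y)"
    by (rule exI[of _ "list_encode (map u [0..<b])"]) (simp add: nth_code_tabulate u)
qed blast

lemma Least_iff:
  fixes P :: "nat \<Rightarrow> bool"
  assumes "\<exists>y. P y"
  shows "F (LEAST y. P y) \<longleftrightarrow> (\<exists>y. P y \<and> (\<forall>y'<y. \<not> P y') \<and> F y)"
  using assms by (metis LeastI Least_le not_less_Least linorder_not_le order_antisym)

text \<open>
  The witnesses for the failure of the finitely many candidates below the least one are packed
  into a list, which is guessed together with that least one.
\<close>

lemma sigma0_2_Least:
  assumes P: "computable_pred3 P" and F: "computable_pred2 F" and ex: "\<And>z. \<exists>y. \<forall>n. P z y n"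
    and A: "\<And>z. z \<in> A \<longleftrightarrow> F z (LEAST y. \<forall>n. P z y n)"
  shows "sigma0 2 A"
proof -
  let ?Q = "\<lambda>z y c n. P z y n \<and> (\<forall>y'<y. \<not> P z y' (nth_code c y')) \<and> F z y"
  have "z \<in> A \<longleftrightarrow> (\<exists>k. \<forall>n. ?Q z (fst (prod_decode k)) (snd (prod_decode k)) n)" for z
  proof -
    have "z \<in> A \<longleftrightarrow> (\<exists>y. (\<forall>n. P z y n) \<and> (\<forall>y'<y. \<exists>n. \<not> P z y' n) \<and> F z y)"
      unfolding A by (subst Least_iff) (use ex in auto)
    also have "\<dots> \<longleftrightarrow> (\<exists>y c. \<forall>n. ?Q z y c n)" unfolding choice_code by auto
    finally show ?thesis unfolding ex_prod_decode .
  qed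
  moreover have "computable_pred3 (\<lambda>z k n. ?Q z (fst (prod_decode k)) (snd (prod_decode k)) n)"
    by (intro computable_intros computable_pred3_compose[OF P] computable_pred2_compose[OF F])
  ultimately show ?thesis
    by (intro sigma0_2I)
qed

text \<open>Failure of a candidate now has the form \<open>\<exists>u. \<forall>v\<close>. The
  witnesses \<open>u\<close> go into the guessed list, the universal \<open>v'\<close> is paired
  with the \<open>u\<close> of the success condition, and a prefix
  \<open>\<exists>\<forall>\<exists>\<close> remains.\<close>

lemma sigma0_3_Least:
  assumes P: "computable_pred4 P" and F: "computable_pred2 F" and ex: "\<And>z. \<exists>y. \<forall>u. \<exists>v. P z y u v"
    and A: "\<And>z. z \<in> A \<longleftrightarrow> F z (LEAST y. \<forall>u. \<exists>v. P z y u v)"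
  shows "sigma0 3 A"
proof -
  let ?Q = "\<lambda>z y c u v' v. P z y u v \<and> (\<forall>y'<y. \<not> P z y' (nth_code c y') v') \<and> F z y"
  have "z \<in> A \<longleftrightarrow> (\<exists>k. \<forall>l. \<exists>v. ?Q z (fst (prod_decode k)) (snd (prod_decode k))
      (fst (prod_decode l)) (snd (prod_decode l)) v)" for z
  proof -
    have "z \<in> A \<longleftrightarrow> (\<exists>y. (\<forall>u. \<exists>v. P z y u v) \<and> (\<forall>y'<y. \<exists>u. \<forall>v. \<not> P z y' u v) \<and> F z y)"
      unfolding A by (subst Least_iff) (use ex in auto)
    also have "\<dots> \<longleftrightarrow> (\<exists>y c. \<forall>u v'. \<exists>v. ?Q z y c u v' v)"
      unfolding choice_code by (rule ex_cong1) blast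
    finally show ?thesis unfolding ex_prod_decode all_prod_decode .
  qed
  moreover have "computable_pred4 (\<lambda>z k l v. ?Q z (fst (prod_decode k)) (snd (prod_decode k))
      (fst (prod_decode l)) (snd (prod_decode l)) v)"
    by (intro computable_intros computable_pred4_compose[OF P] computable_pred2_compose[OF F])
  ultimately show ?thesis by (intro sigma0_3I)
qed

text \<open>The least witness is a total function of \<open>z\<close>, so the complement of
  \<open>A\<close> is given by the same search followed by the negated test.\<close>

lemma delta0_2_Least:
  assumes P: "computable_pred3 P" and F: "computable_pred2 F" and ex: "\<And>z. \<exists>y. \<forall>n. P z y n"
    and A: "\<And>z. z \<in> A \<longleftrightarrow> F z (LEAST y. \<forall>n. P z y n)"
  shows "delta0 2 A"
proof -
  have F': "computable_pred2 (\<lambda>z y. \<not> F z y)"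
    by (intro computable_intros computable_pred2_compose[OF F])
  show ?thesis unfolding delta0_def
    using sigma0_2_Least[OF P F ex A] sigma0_2_Least[OF P F' ex, of "- A"] A pi0_if_sigma0_Compl by auto
qed

lemma delta0_3_Least:
  assumes P: "computable_pred4 P" and F: "computable_pred2 F" and ex: "\<And>z. \<exists>y. \<forall>u. \<exists>v. P z y u v"
    and A: "\<And>z. z \<in> A \<longleftrightarrow> F z (LEAST y. \<forall>u. \<exists>v. P z y u v)"
  shows "delta0 3 A"
proof -
  have F': "computable_pred2 (\<lambda>z y. \<not> F z y)"
    by (intro computable_intros computable_pred2_compose[OF F])
  show ?thesis unfolding delta0_def
    using sigma0_3_Least[OF P F ex A] sigma0_3_Least[OF P F' ex, of "- A"] A pi0_if_sigma0_Compl by auto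
qed

section \<open>Values as sums over reachable histories\<close>

fun follows :: "('a, 'e) policy \<Rightarrow> ('a, 'e) history \<Rightarrow> ('a, 'e) history \<Rightarrow> bool" where
  "follows \<pi> h [] \<longleftrightarrow> True"
| "follows \<pi> h ((a, e) # z) \<longleftrightarrow> a = \<pi> h \<and> follows \<pi> (h @ [(a, e)]) z"

primrec leaf_sum :: "('a, 'e::finite) env \<Rightarrow> ('a, 'e) policy \<Rightarrow> nat \<Rightarrow> ('a, 'e) history \<Rightarrow> real" where
  "leaf_sum G \<pi> 0 h = G h"
| "leaf_sum G \<pi> (Suc d) h = (\<Sum>e\<in>UNIV. leaf_sum G \<pi> d (h @ [(\<pi> h, e)]))"

primrec opt_sum :: "('a::finite, 'e::finite) env \<Rightarrow> nat \<Rightarrow> ('a, 'e) history \<Rightarrow> real" where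
  "opt_sum G 0 h = G h"
| "opt_sum G (Suc d) h = Max (range (\<lambda>a. \<Sum>e\<in>UNIV. opt_sum G d (h @ [(a, e)])))"

definition act_sum :: "('a::finite, 'e::finite) env \<Rightarrow> nat \<Rightarrow> ('a, 'e) history \<Rightarrow> 'a \<Rightarrow> real" where
  "act_sum G d h a = (\<Sum>e\<in>UNIV. opt_sum G d (h @ [(a, e)]))"

lemma opt_sum_Suc: "opt_sum G (Suc d) h = Max (range (act_sum G d h))"
  by (simp add: act_sum_def[abs_def])

declare opt_sum.simps(2) [simp del]

lemma sum_length_Suc:
  fixes f :: "'x::finite list \<Rightarrow> real"
  shows "(\<Sum>z | length z = Suc d. f z) = (\<Sum>x\<in>UNIV. \<Sum>z | length z = d. f (x # z))"
proof -
  have "{z :: 'x list. length z = Suc d} = (\<lambda>(x, z). x # z) ` (UNIV \<times> {z. length z = d})"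
    by (auto simp: length_Suc_conv image_iff)
  moreover have "inj_on (\<lambda>(x, z). x # z) (UNIV \<times> {z :: 'x list. length z = d})"
    by (auto simp: inj_on_def)
  ultimately show ?thesis
    by (simp add: sum.reindex comp_def case_prod_unfold sum.cartesian_product)
qed

lemma sum_follows:
  fixes \<pi> :: "('a::finite, 'e::finite) policy"
  shows "(\<Sum>z | length z = d. if follows \<pi> h z then G (h @ z) else 0) = leaf_sum G \<pi> d h"
proof (induction d arbitrary: h)
  case (Suc d)
  have "(\<Sum>z | length z = Suc d. if follows \<pi> h z then G (h @ z) else 0)
    = (\<Sum>x\<in>UNIV \<times> UNIV. \<Sum>z | length z = d. if follows \<pi> h (x # z) then G (h @ x # z) else 0)"
    by (simp add: sum_length_Suc)
  also have "\<dots> = (\<Sum>a\<in>UNIV. \<Sum>e\<in>UNIV. \<Sum>z | length z = d. if a = \<pi> h \<and> follows \<pi> (h @ [(a, e)]) z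
         then G ((h @ [(a, e)]) @ z) else 0)"
  proof -
    have "(\<Sum>x\<in>UNIV \<times> UNIV. F x) = (\<Sum>a\<in>UNIV. \<Sum>e\<in>UNIV. F (a, e))" for F :: "'a \<times> 'e \<Rightarrow> real"
      by (simp add: sum.cartesian_product case_prod_beta')
    then show ?thesis by (simp cong: if_cong)
  qed
  also have "\<dots> = (\<Sum>a\<in>UNIV. if a = \<pi> h then \<Sum>e\<in>UNIV. leaf_sum G \<pi> d (h @ [(a, e)]) else 0)"
    by (rule sum.cong) (auto simp: Suc.IH[symmetric])
  finally show ?case by simp
qed simp

lemma leaf_sum_add: "leaf_sum (\<lambda>h. F h + G h) \<pi> d h = leaf_sum F \<pi> d h + leaf_sum G \<pi> d h"
  by (induction d arbitrary: h) (auto simp: sum.distrib)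

lemma leaf_sum_cmult: "leaf_sum (\<lambda>h. c * G h) \<pi> d h = c * leaf_sum G \<pi> d h"
  by (induction d arbitrary: h) (auto simp: sum_distrib_left)

lemma leaf_sum_const: "leaf_sum (\<lambda>h. c) (\<pi> :: ('a, 'e::finite) policy) d h = real (CARD('e) ^ d) * c"
  by (induction d arbitrary: h) auto

lemma leaf_sum_measure:
  assumes "\<And>h a. (\<Sum>e\<in>UNIV. \<rho> (h @ [(a, e)])) = \<rho> h"
  shows "leaf_sum \<rho> \<pi> d h = \<rho> h"
  by (induction d arbitrary: h) (auto simp: assms)

lemma chron_semimeasureD:
  assumes "chron_semimeasure \<rho>"
  shows "0 \<le> \<rho> h" "\<rho> h \<le> 1" "\<rho> (h @ z) \<le> \<rho> h"
proof -
  show ge: "0 \<le> \<rho> h" for h using assms unfolding chron_semimeasure_def by auto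
  show "\<rho> h \<le> 1" using assms unfolding chron_semimeasure_def by auto
  show "\<rho> (h @ z) \<le> \<rho> h"
  proof (induction z rule: rev_induct)
    case (snoc x z)
    obtain a e where x: "x = (a, e)" by (cases x)
    have "\<rho> (h @ z @ [x]) \<le> (\<Sum>e\<in>UNIV. \<rho> ((h @ z) @ [(a, e)]))"
      using member_le_sum[of e UNIV "\<lambda>e. \<rho> ((h @ z) @ [(a, e)])"] ge x by simp
    also have "\<dots> \<le> \<rho> (h @ z)" using assms unfolding chron_semimeasure_def by blast
    finally show ?case using snoc by simp
  qed simp
qed

lemma semimeasure_append_eq_0:
  assumes "chron_semimeasure \<rho>" "\<rho> h = 0" shows "\<rho> (h @ z) = 0"
  using chron_semimeasureD(1)[OF assms(1), of "h @ z"] chron_semimeasureD(3)[OF assms(1), of h z] assms(2) by simp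

text \<open>The conditional probabilities telescope. Where an intermediate mass is 0, monotonicity
  makes \<open>\<rho> (h @ z)\<close> vanish as well, so the division by 0 does no harm.\<close>

lemma cont_prob_eq:
  assumes \<rho>: "chron_semimeasure \<rho>" and "\<rho> h > 0"
  shows "cont_prob \<rho> \<pi> h z = (if follows \<pi> h z then \<rho> (h @ z) / \<rho> h else 0)"
  using assms(2)
proof (induction z arbitrary: h)
  case (Cons x z)
  obtain a e where x: "x = (a, e)" by (cases x)
  show ?case
  proof (cases "\<rho> (h @ [x]) > 0")
    case True
    then show ?thesis using Cons.IH[OF True] True by (auto simp: x)
  next
    case False
    then have "\<rho> (h @ [x]) = 0" using chron_semimeasureD(1)[OF \<rho>, of "h @ [x]"] by simp
    then show ?thesis using semimeasure_append_eq_0[OF \<rho>, of "h @ [x]" z] by (auto simp: x)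
  qed
qed simp

lemma leaf_sum_le_opt_sum: "leaf_sum G \<pi> d h \<le> opt_sum G d h"
proof (induction d arbitrary: h)
  case (Suc d)
  have "leaf_sum G \<pi> (Suc d) h \<le> act_sum G d h (\<pi> h)"
    by (simp add: act_sum_def sum_mono Suc)
  also have "\<dots> \<le> opt_sum G (Suc d) h" by (simp add: opt_sum_Suc)
  finally show ?case .
qed simp

text \<open>Extensions of a null history are null, so every leaf below it carries \<open>c\<close>,
  whichever actions are taken.\<close>

lemma opt_sum_eq_const:
  fixes G :: "('a::finite, 'e::finite) env"
  assumes \<rho>: "chron_semimeasure \<rho>" and "\<rho> h = 0" and G: "\<And>h. \<rho> h = 0 \<Longrightarrow> G h = c"
  shows "opt_sum G d h = real (CARD('e) ^ d) * c"
  using assms(2)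
proof (induction d arbitrary: h)
  case (Suc d)
  have "\<rho> (h @ [x]) = 0" for x using semimeasure_append_eq_0[OF \<rho> Suc.prems] by blast
  then show ?case by (simp add: opt_sum_Suc act_sum_def[abs_def] Suc.IH image_constant_conv)
qed (simp add: G)

text \<open>The decision at a node \<open>h'\<close> loses at most
  \<open>\<delta> * \<rho> h'\<close>. The masses of the nodes that the policy reaches at one level
  add up to \<open>\<rho> h\<close>, so each of the \<open>d\<close> levels costs at most
  \<open>\<delta> * \<rho> h\<close>.\<close>

lemma opt_sum_le_greedy:
  fixes \<pi> :: "('a::finite, 'e::finite) policy"
  assumes \<rho>: "\<And>h a. (\<Sum>e\<in>UNIV. \<rho> (h @ [(a, e)])) = \<rho> h"
    and greedy: "\<And>h b. act_sum G (m - length h - 1) h b \<le> act_sum G (m - length h - 1) h (\<pi> h) + \<delta> * \<rho> h"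
  shows "length h + d = m \<Longrightarrow> opt_sum G d h \<le> leaf_sum G \<pi> d h + real d * \<delta> * \<rho> h"
proof (induction d arbitrary: h)
  case (Suc d)
  have d: "m - length h - 1 = d" using Suc.prems by simp
  have "opt_sum G (Suc d) h \<le> act_sum G d h (\<pi> h) + \<delta> * \<rho> h"
    unfolding opt_sum_Suc using greedy[of h] d by simp
  also have "act_sum G d h (\<pi> h) \<le>
      (\<Sum>e\<in>UNIV. leaf_sum G \<pi> d (h @ [(\<pi> h, e)]) + real d * \<delta> * \<rho> (h @ [(\<pi> h, e)]))"
    unfolding act_sum_def by (intro sum_mono Suc.IH) (use Suc.prems in auto)
  also have "\<dots> = leaf_sum G \<pi> (Suc d) h + real d * \<delta> * \<rho> h"
    by (simp add: sum.distrib \<rho> sum_distrib_left[symmetric])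
  finally show ?case by (simp add: algebra_simps)
qed simp

text \<open>The term \<open>C h\<close> is the same for both policies and cancels; dividing by
  \<open>\<rho> h\<close> turns the relative slack into an absolute one.\<close>

lemma greedy_value:
  fixes V :: "('a::finite, 'e::finite) policy \<Rightarrow> nat \<Rightarrow> ('a, 'e) history \<Rightarrow> real"
  assumes \<rho>: "\<And>h a. (\<Sum>e\<in>UNIV. \<rho> (h @ [(a, e)])) = \<rho> h" and "\<rho> h > 0" and "\<delta> \<ge> 0"
    and V: "\<And>\<pi> h. \<rho> h > 0 \<Longrightarrow> length h < m \<Longrightarrow> \<rho> h * V \<pi> m h = leaf_sum G \<pi> (m - length h) h - C h"
    and V0: "\<And>\<pi> h. m \<le> length h \<Longrightarrow> V \<pi> m h = 0"
    and greedy: "\<And>h b. act_sum G (m - length h - 1) h b \<le> act_sum G (m - length h - 1) h (\<pi> h) + \<delta> * \<rho> h"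
  shows "V \<pi>' m h \<le> V \<pi> m h + real m * \<delta>"
proof (cases "length h < m")
  case True
  have "\<rho> h * V \<pi>' m h \<le> opt_sum G (m - length h) h - C h"
    using V[OF \<open>\<rho> h > 0\<close> True, of \<pi>'] leaf_sum_le_opt_sum[of G \<pi>' "m - length h" h] by simp
  also have "\<dots> \<le> \<rho> h * V \<pi> m h + real (m - length h) * \<delta> * \<rho> h"
    using V[OF \<open>\<rho> h > 0\<close> True, of \<pi>] opt_sum_le_greedy[where \<rho> = \<rho> and \<pi> = \<pi> and h = h, OF \<rho> greedy, of "m - length h"] True by simp
  also have "\<dots> \<le> \<rho> h * V \<pi> m h + real m * \<delta> * \<rho> h"
    using assms(2,3) by (intro add_left_mono mult_right_mono) auto
  also have "\<dots> = \<rho> h * (V \<pi> m h + real m * \<delta>)" by (simp add: algebra_simps)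
  finally show ?thesis using \<open>\<rho> h > 0\<close> by simp
qed (use V0 assms(3) in auto)

section \<open>Histories and policies as numbers\<close>

definition snoc_code :: "('a::finite) \<Rightarrow> 'e::finite \<Rightarrow> nat \<Rightarrow> nat" where
  "snoc_code a e c = list_encode (list_decode c @ [prod_encode (to_nat a, to_nat e)])"

lemma computable_fun_snoc_code [computable_intros]:
  "computable_fun f \<Longrightarrow> computable_fun (\<lambda>x. snoc_code a e (f x))"
  unfolding snoc_code_def by (intro computable_intros)

lemma hist_code_snoc: "hist_code (h @ [(a, e)]) = snoc_code a e (hist_code h)"
  by (simp add: hist_code_def snoc_code_def)

lemma length_hist_code [simp]: "length (list_decode (hist_code h)) = length h"
  by (simp add: hist_code_def)

lemma hist_code_eq_iff [simp]: "hist_code g = hist_code h \<longleftrightarrow> g = h"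
proof -
  have "inj (\<lambda>(a :: 'a, e :: 'b). prod_encode (to_nat a, to_nat e))" by (auto simp: inj_def)
  then show ?thesis by (auto simp: hist_code_def list_encode_eq inj_eq)
qed

text \<open>Convergence is known only at codes of histories, and only these occur in
  \<open>policies_graph\<close>, so the searches must decide which numbers are such codes. The
  alphabets being finite, this is a bounded check.\<close>

definition valid_code :: "('a::finite \<times> 'e::finite) itself \<Rightarrow> nat \<Rightarrow> bool" where
  "valid_code T c \<longleftrightarrow> (\<forall>k<length (list_decode c). \<exists>(a::'a) (e::'e). nth_code c k = prod_encode (to_nat a, to_nat e))"

lemma computable_pred_valid_code [computable_intros]:
  "computable_fun f \<Longrightarrow> computable_pred (\<lambda>x. valid_code T (f x))"
proof (erule computable_pred_compose[rotated])
  show "computable_pred (valid_code T)"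
    unfolding valid_code_def[abs_def] by (intro computable_intros)
qed

lemma valid_code_iff: "valid_code TYPE('a::finite \<times> 'e::finite) c \<longleftrightarrow> (\<exists>h :: ('a, 'e) history. c = hist_code h)"
proof
  assume *: "valid_code TYPE('a \<times> 'e) c"
  have "\<forall>x\<in>set (list_decode c). \<exists>p :: 'a \<times> 'e. x = (case p of (a, e) \<Rightarrow> prod_encode (to_nat a, to_nat e))"
    using * by (fastforce simp: valid_code_def nth_code_def in_set_conv_nth)
  then obtain p where p: "\<And>x. x \<in> set (list_decode c) \<Longrightarrow>
      x = (case p x :: 'a \<times> 'e of (a, e) \<Rightarrow> prod_encode (to_nat a, to_nat e))" by metis
  have "map (\<lambda>(a, e). prod_encode (to_nat a, to_nat e)) (map p (list_decode c)) = list_decode c"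
    by (rule nth_equalityI) (use p in auto)
  then have "c = hist_code (map p (list_decode c))" unfolding hist_code_def by simp
  then show "\<exists>h :: ('a, 'e) history. c = hist_code h" by blast
next
  assume "\<exists>h :: ('a, 'e) history. c = hist_code h"
  then obtain h :: "('a, 'e) history" where h: "c = hist_code h" by blast
  show "valid_code TYPE('a \<times> 'e) c"
    unfolding valid_code_def h
    by (auto simp: nth_code_def hist_code_def case_prod_unfold)
qed

text \<open>Brings the graph into the form of a decidable test on the selected number
  \<open>\<kappa> t c\<close>, as the lemmas on least witnesses require.\<close>

lemma policies_graph_iff:
  fixes \<kappa> :: "nat \<Rightarrow> nat \<Rightarrow> nat"
  assumes \<kappa>: "\<And>t c. \<exists>a::'a::finite. \<kappa> t c = to_nat a"
  shows "z \<in> policies_graph (\<lambda>t (h :: ('a, 'e::finite) history). from_nat (\<kappa> t (hist_code h))) \<longleftrightarrow>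
    valid_code TYPE('a \<times> 'e) (fst (prod_decode (snd (prod_decode z)))) \<and>
    \<kappa> (fst (prod_decode z)) (fst (prod_decode (snd (prod_decode z)))) = snd (prod_decode (snd (prod_decode z)))"
proof -
  define t c k where "t = fst (prod_decode z)" and "c = fst (prod_decode (snd (prod_decode z)))"
    and "k = snd (prod_decode (snd (prod_decode z)))"
  have z: "z = prod_encode (t, prod_encode (c, k))" by (simp add: t_def c_def k_def)
  have [simp]: "to_nat (from_nat (\<kappa> t c) :: 'a) = \<kappa> t c" for t c using \<kappa>[of t c] by auto
  have "z \<in> policies_graph (\<lambda>t (h :: ('a, 'e) history). from_nat (\<kappa> t (hist_code h))) \<longleftrightarrow>
     (\<exists>h :: ('a, 'e) history. c = hist_code h \<and> k = \<kappa> t c)"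
    by (auto simp: policies_graph_def z)
  then show ?thesis unfolding valid_code_iff t_def[symmetric] c_def[symmetric] k_def[symmetric] by auto
qed

lemma tendsto_Max_range:
  fixes f :: "'i::finite \<Rightarrow> nat \<Rightarrow> real"
  assumes "\<And>i. f i \<longlonglongrightarrow> l i"
  shows "(\<lambda>n. Max (range (\<lambda>i. f i n))) \<longlonglongrightarrow> Max (range l)"
proof -
  have "(\<lambda>n. Max ((\<lambda>i. f i n) ` S)) \<longlonglongrightarrow> Max (l ` S)" if "finite S" "S \<noteq> {}" for S
    using that by (induction rule: finite_ne_induct) (auto intro!: tendsto_max assms)
  then show ?thesis by simp
qed

lemma Max_divide_power: "real (Max (range f)) / 2 ^ n = Max (range (\<lambda>i::'i::finite. real (f i) / 2 ^ n))"
proof -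
  have "mono (\<lambda>k. real k / 2 ^ n)" by (auto intro!: monoI divide_right_mono)
  from mono_Max_commute[OF this, of "range f"] show ?thesis by (simp add: image_image)
qed

lemma tendsto_tree_value:
  fixes G :: "('a::finite, 'e::finite) env"
  assumes "\<And>h. (\<lambda>n. real (g n (hist_code h)) / 2 ^ n) \<longlonglongrightarrow> G h"
  shows "(\<lambda>n. real (tree_value (g n) (snoc_code :: 'a \<Rightarrow> 'e \<Rightarrow> nat \<Rightarrow> nat) d (hist_code h)) / 2 ^ n) \<longlonglongrightarrow> opt_sum G d h"
proof (induction d arbitrary: h)
  case (Suc d)
  show ?case
    unfolding opt_sum_Suc act_sum_def tree_value.simps Max_divide_power of_nat_sum sum_divide_distrib
    by (intro tendsto_Max_range tendsto_sum) (use Suc in \<open>simp add: hist_code_snoc[symmetric]\<close>)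
qed (simp add: assms)

section \<open>Nearly greedy and greedy policies\<close>

text \<open>
  Multiplied by \<open>\<rho> h\<close>, the value of a policy is, up to a term that does not depend on the policy, a sum
  of \<open>G\<close> over the histories it can reach at the horizon.  Approximations of \<open>G\<close> then converge even
  where \<open>\<rho> h = 0\<close>, unlike those of the value itself.  \<open>S\<close> enumerates the support of \<open>\<rho>\<close>; it lets the
  \<open>\<epsilon>\<close>-optimal policies converge off the support, where every action is tolerated.
\<close>

locale approximable_value =
  fixes \<rho> :: "('a::finite, 'e::finite) env" and G :: "('a, 'e) env"
    and V :: "('a, 'e) policy \<Rightarrow> nat \<Rightarrow> ('a, 'e) history \<Rightarrow> real"
    and m :: "nat \<Rightarrow> nat" and C :: "nat \<Rightarrow> ('a, 'e) history \<Rightarrow> real" and c0 :: real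
    and g r :: "nat \<Rightarrow> nat \<Rightarrow> nat" and S :: "nat \<Rightarrow> nat \<Rightarrow> bool"
  assumes \<rho>: "chron_measure \<rho>"
    and g: "computable_fun2 g" "\<And>h. (\<lambda>n. real (g n (hist_code h)) / 2 ^ n) \<longlonglongrightarrow> G h"
    and r: "computable_fun2 r" "\<And>h. (\<lambda>n. real (r n (hist_code h)) / 2 ^ n) \<longlonglongrightarrow> \<rho> h"
    and S: "computable_pred2 S" "\<And>h. \<rho> h > 0 \<longleftrightarrow> (\<exists>n. S n (hist_code h))"
    and G0: "\<And>h. \<rho> h = 0 \<Longrightarrow> G h = c0"
    and m: "computable_fun m"
    and V: "\<And>\<pi> M h. \<rho> h > 0 \<Longrightarrow> length h < M \<Longrightarrow> \<rho> h * V \<pi> M h = leaf_sum G \<pi> (M - length h) h - C M h"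
    and V0: "\<And>\<pi> M h. M \<le> length h \<Longrightarrow> V \<pi> M h = 0"
begin

lemma sum_\<rho>: "(\<Sum>e\<in>UNIV. \<rho> (h @ [(a, e)])) = \<rho> h"
  using \<rho> unfolding chron_measure_def by blast

lemma semimeasure_\<rho>: "chron_semimeasure \<rho>"
  using \<rho> unfolding chron_measure_def by blast

definition q :: "nat \<Rightarrow> nat \<Rightarrow> nat \<Rightarrow> nat \<Rightarrow> nat" where
  "q t c k n = (\<Sum>e\<in>UNIV. tree_value (g n) (snoc_code :: 'a \<Rightarrow> 'e \<Rightarrow> nat \<Rightarrow> nat)
     (m t - length (list_decode c) - 1) (list_encode (list_decode c @ [prod_encode (k, to_nat (e::'e))])))"

abbreviation Q :: "nat \<Rightarrow> ('a, 'e) history \<Rightarrow> 'a \<Rightarrow> real" where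
  "Q t h a \<equiv> act_sum G (m t - length h - 1) h a"

lemma computable_fun_q [computable_intros]:
  assumes "computable_fun f1" "computable_fun f2" "computable_fun f3" "computable_fun f4"
  shows "computable_fun (\<lambda>x. q (f1 x) (f2 x) (f3 x) (f4 x))"
  unfolding q_def
  by (intro computable_intros computable_fun3_compose[OF computable_fun_tree_value[OF g(1)]]
      computable_fun_compose[OF m] assms)

lemma tendsto_q: "(\<lambda>n. real (q t (hist_code h) (to_nat a) n) / 2 ^ n) \<longlonglongrightarrow> Q t h a"
  unfolding q_def act_sum_def of_nat_sum sum_divide_distrib
  using tendsto_tree_value[of g G, OF g(2)]
  by (auto intro!: tendsto_sum simp: snoc_code_def[symmetric] hist_code_snoc[symmetric])

lemma ex_best: "\<exists>a. \<forall>b. Q t h b \<le> Q t h a"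
proof -
  have "Max (range (Q t h)) \<in> range (Q t h)" by (intro Max_in) auto
  then obtain a where "Max (range (Q t h)) = Q t h a" by (rule imageE)
  then show ?thesis by (metis Max_ge finite finite_imageI rangeI)
qed

lemma opt_value_le:
  assumes "\<rho> h > 0" "\<delta> \<ge> 0" and greedy: "\<And>h b. Q t h b \<le> Q t h (\<pi> h) + \<delta> * \<rho> h"
  shows "opt_value V (m t) h \<le> V \<pi> (m t) h + real (m t) * \<delta>" "V \<pi> (m t) h \<le> opt_value V (m t) h"
proof -
  have le: "V \<pi>' (m t) h \<le> V \<pi> (m t) h + real (m t) * \<delta>" for \<pi>'
    by (rule greedy_value[where \<rho> = \<rho> and G = G and C = "C (m t)"])
      (use assms sum_\<rho> V V0 in auto)
  show "opt_value V (m t) h \<le> V \<pi> (m t) h + real (m t) * \<delta>"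
    unfolding opt_value_def by (rule cSUP_least) (use le in auto)
  show "V \<pi> (m t) h \<le> opt_value V (m t) h"
    unfolding opt_value_def by (rule cSUP_upper) (use le in \<open>auto intro!: bdd_aboveI2\<close>)
qed

text \<open>On null histories the slack \<open>\<delta> * \<rho> h\<close> is 0, so near greediness
  there demands exact ties between the actions; the constancy of \<open>G\<close> off the support
  supplies them.\<close>

lemma Q_eq_if_null: "\<rho> h = 0 \<Longrightarrow> Q t h a = Q t h b"
  unfolding act_sum_def
  using semimeasure_append_eq_0[OF semimeasure_\<rho>, of h] opt_sum_eq_const[OF semimeasure_\<rho> _ G0] by simp

text \<open>The comparison of the stage \<open>n\<close> values with slack
  \<open>\<rho> h / (Suc (m t) * Suc K)\<close>, cleared of denominators. The factor
  \<open>Suc (m t)\<close> pays for the number of decisions, \<open>Suc K\<close> for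
  \<open>\<epsilon>\<close>.\<close>

definition near_greedy :: "nat \<Rightarrow> nat \<Rightarrow> nat \<Rightarrow> nat \<Rightarrow> nat \<Rightarrow> bool" where
  "near_greedy K t c k n \<longleftrightarrow> (\<forall>b::'a. Suc (m t) * Suc K * q t c (to_nat b) n \<le> Suc (m t) * Suc K * q t c k n + r n c)"

text \<open>
  \<open>y\<close> encodes an action together with a stage from which on it stays nearly greedy.  The property
  is universal in \<open>l\<close>, so the least \<open>y\<close> is limit computable although no rate of convergence is known.
\<close>

definition eps_choice :: "nat \<Rightarrow> nat \<Rightarrow> nat \<Rightarrow> nat \<Rightarrow> nat \<Rightarrow> bool" where
  "eps_choice K t c y l \<longleftrightarrow> (\<exists>a::'a. fst (prod_decode y) = to_nat a) \<and>
     (valid_code TYPE('a \<times> 'e) c \<and> S (fst (prod_decode l)) c \<and> snd (prod_decode y) \<le> snd (prod_decode l)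
       \<longrightarrow> near_greedy K t c (fst (prod_decode y)) (snd (prod_decode l)))"

lemma ex_eps_choice: "\<exists>y. \<forall>l. eps_choice K t c y l"
proof (cases "\<exists>h :: ('a, 'e) history. c = hist_code h \<and> \<rho> h > 0")
  case True
  then obtain h :: "('a, 'e) history" where h: "c = hist_code h" "\<rho> h > 0" by blast
  obtain a where a: "\<And>b. Q t h b \<le> Q t h a" using ex_best by blast
  define M where "M = Suc (m t) * Suc K"
  have "\<forall>\<^sub>F n in sequentially. M * q t c (to_nat b) n \<le> M * q t c (to_nat a) n + r n c" for b :: 'a
  proof -
    have "(\<lambda>n. real M * (real (q t c (to_nat b) n) / 2 ^ n) - real M * (real (q t c (to_nat a) n) / 2 ^ n)
        - real (r n c) / 2 ^ n) \<longlonglongrightarrow> real M * Q t h b - real M * Q t h a - \<rho> h"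
      unfolding h by (intro tendsto_intros tendsto_q r)
    moreover have "real M * Q t h b \<le> real M * Q t h a" by (intro mult_left_mono a) auto
    \<comment> \<open>Positivity of \<open>\<rho> h\<close> makes the limit inequality strict, so
      that it holds from some stage on.\<close>
    then have "real M * Q t h b - real M * Q t h a - \<rho> h < 0" using h(2) by linarith
    ultimately have "\<forall>\<^sub>F n in sequentially. real M * (real (q t c (to_nat b) n) / 2 ^ n)
        - real M * (real (q t c (to_nat a) n) / 2 ^ n) - real (r n c) / 2 ^ n < 0"
      by (rule order_tendstoD(2))
    then show ?thesis
    proof eventually_elim
      case (elim n)
      then have "(real M * real (q t c (to_nat b) n) - (real M * real (q t c (to_nat a) n) + real (r n c))) / 2 ^ n < 0"
        by (simp add: diff_divide_distrib add_divide_distrib)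
      then have "real M * real (q t c (to_nat b) n) \<le> real M * real (q t c (to_nat a) n) + real (r n c)"
        by (simp add: divide_less_0_iff)
      then show ?case by (metis of_nat_add of_nat_mult of_nat_le_iff)
    qed
  qed
  then have "\<forall>\<^sub>F n in sequentially. \<forall>b::'a. M * q t c (to_nat b) n \<le> M * q t c (to_nat a) n + r n c"
    by (rule eventually_all_finite)
  then obtain N where "\<And>n. n \<ge> N \<Longrightarrow> near_greedy K t c (to_nat a) n"
    unfolding eventually_sequentially near_greedy_def M_def by blast
  then have "\<forall>l. eps_choice K t c (prod_encode (to_nat a, N)) l" unfolding eps_choice_def by auto
  then show ?thesis by blast
next
  case False
  \<comment> \<open>Neither a null history nor a number that codes no history ever triggers the
    premise, so any action with stage 0 is accepted.\<close>
  then have "\<not> (valid_code TYPE('a \<times> 'e) c \<and> S n c)" for n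
    unfolding valid_code_iff using S(2) by auto
  then have "eps_choice K t c (prod_encode (to_nat (undefined :: 'a), 0)) l" for l
    unfolding eps_choice_def by auto
  then show ?thesis by blast
qed

lemma eps_optimal_policies:
  assumes "\<epsilon> > 0"
  shows "\<exists>\<pi>. delta0 2 (policies_graph \<pi>) \<and>
    (\<forall>t h. \<rho> h > 0 \<longrightarrow> opt_value V (m t) h - V (\<pi> t) (m t) h < \<epsilon>)"
proof -
  obtain K where K: "inverse (real (Suc K)) < \<epsilon>" using reals_Archimedean[OF assms] by blast
  define y where "y t c = (LEAST y. \<forall>l. eps_choice K t c y l)" for t c
  define \<kappa> where "\<kappa> t c = fst (prod_decode (y t c))" for t c
  define \<pi> where "\<pi> t (h :: ('a, 'e) history) = (from_nat (\<kappa> t (hist_code h)) :: 'a)" for t h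
  have y: "eps_choice K t c (y t c) l" for t c l
    using LeastI_ex[OF ex_eps_choice[of K t c]] unfolding y_def by blast
  have \<kappa>: "\<exists>a::'a. \<kappa> t c = to_nat a" for t c using y[of t c] unfolding eps_choice_def \<kappa>_def by blast
  then have \<kappa>_eq: "\<kappa> t (hist_code h) = to_nat (\<pi> t h)" for t h unfolding \<pi>_def by (metis from_nat_to_nat)
  have "delta0 2 (policies_graph \<pi>)"
  proof (rule delta0_2_Least)
    show "computable_pred3 (\<lambda>z. eps_choice K (fst (prod_decode z)) (fst (prod_decode (snd (prod_decode z)))))"
      unfolding eps_choice_def near_greedy_def
      by (intro computable_intros computable_pred2_compose[OF S(1)] computable_fun_compose[OF m]
          computable_fun2_compose[OF r(1)])
    show "\<exists>y. \<forall>n. eps_choice K (fst (prod_decode z)) (fst (prod_decode (snd (prod_decode z)))) y n" for z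
      by (rule ex_eps_choice)
    let ?F = "\<lambda>z y. valid_code TYPE('a \<times> 'e) (fst (prod_decode (snd (prod_decode z)))) \<and>
       fst (prod_decode y) = snd (prod_decode (snd (prod_decode z)))"
    show "computable_pred2 ?F" by (intro computable_intros)
    show "z \<in> policies_graph \<pi> \<longleftrightarrow> ?F z (LEAST y. \<forall>n. eps_choice K (fst (prod_decode z))
        (fst (prod_decode (snd (prod_decode z)))) y n)" for z
      using policies_graph_iff[where \<kappa> = \<kappa> and 'e = 'e, OF \<kappa>, of z] unfolding \<pi>_def[abs_def] \<kappa>_def y_def .
  qed
  moreover have "opt_value V (m t) h - V (\<pi> t) (m t) h < \<epsilon>" if "\<rho> h > 0" for t h
  proof -
    define M where "M = Suc (m t) * Suc K"
    have "Q t h b \<le> Q t h (\<pi> t h) + 1 / real M * \<rho> h" for h b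
    proof (cases "\<rho> h > 0")
      case True
      \<comment> \<open>The stage \<open>i\<close> confirming the support stays fixed while the
        stage \<open>n\<close> of the comparison runs to infinity; this is why \<open>l\<close>
        codes two independent stages.\<close>
      then obtain i where i: "S i (hist_code h)" using S(2) by blast
      obtain N where N: "\<And>l. N \<le> snd (prod_decode l) \<Longrightarrow> S (fst (prod_decode l)) (hist_code h) \<Longrightarrow>
          near_greedy K t (hist_code h) (to_nat (\<pi> t h)) (snd (prod_decode l))"
        using y[of t "hist_code h"] valid_code_iff[where 'a = 'a and 'e = 'e]
        unfolding eps_choice_def \<kappa>_def[symmetric] \<kappa>_eq by blast
      have "near_greedy K t (hist_code h) (to_nat (\<pi> t h)) n" if "n \<ge> N" for n
        using N[of "prod_encode (i, n)"] i that by simp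
      then have le: "M * q t (hist_code h) (to_nat b) n \<le> M * q t (hist_code h) (to_nat (\<pi> t h)) n + r n (hist_code h)"
        if "n \<ge> N" for n using that unfolding near_greedy_def M_def by blast
      have "real M * Q t h b \<le> real M * Q t h (\<pi> t h) + \<rho> h"
      proof (rule LIMSEQ_le)
        show "(\<lambda>n. real M * (real (q t (hist_code h) (to_nat b) n) / 2 ^ n)) \<longlonglongrightarrow> real M * Q t h b"
          by (intro tendsto_intros tendsto_q)
        show "(\<lambda>n. real M * (real (q t (hist_code h) (to_nat (\<pi> t h)) n) / 2 ^ n) + real (r n (hist_code h)) / 2 ^ n)
            \<longlonglongrightarrow> real M * Q t h (\<pi> t h) + \<rho> h"
          by (intro tendsto_intros tendsto_q r)
        have "real M * (real (q t (hist_code h) (to_nat b) n) / 2 ^ n)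
          \<le> real M * (real (q t (hist_code h) (to_nat (\<pi> t h)) n) / 2 ^ n) + real (r n (hist_code h)) / 2 ^ n" if "n \<ge> N" for n
          using divide_right_mono[OF of_nat_mono[OF le[OF that], where 'a = real], of "2 ^ n"] by (simp add: add_divide_distrib)
        then show "\<exists>N. \<forall>n\<ge>N. real M * (real (q t (hist_code h) (to_nat b) n) / 2 ^ n)
          \<le> real M * (real (q t (hist_code h) (to_nat (\<pi> t h)) n) / 2 ^ n) + real (r n (hist_code h)) / 2 ^ n" by blast
      qed
      moreover have "real M > 0" unfolding M_def of_nat_0_less_iff by simp
      ultimately show ?thesis by (simp add: field_simps)
    next
      case False
      then have "\<rho> h = 0" using chron_semimeasureD(1)[OF semimeasure_\<rho>, of h] by simp
      then show ?thesis using Q_eq_if_null[of h t b "\<pi> t h"] by simp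
    qed
    \<comment> \<open>At most \<open>m t\<close> decisions, each with slack \<open>1 / M\<close>,
      give a loss below \<open>1 / Suc K\<close>.\<close>
    from opt_value_le(1)[OF that _ this]
    have "opt_value V (m t) h - V (\<pi> t) (m t) h \<le> real (m t) * (1 / real M)" by simp
    also have "\<dots> = (real (m t) / real (Suc (m t))) * inverse (real (Suc K))"
      unfolding M_def of_nat_mult by (simp add: divide_simps)
    also have "\<dots> \<le> 1 * inverse (real (Suc K))"
      by (intro mult_right_mono) (auto simp: divide_simps)
    finally show ?thesis using K by simp
  qed
  ultimately show ?thesis by blast
qed

text \<open>
  Since the approximations converge, \<open>Q t h b \<le> Q t h a\<close> already holds if, for every tolerance, it
  holds up to this tolerance at infinitely many stages.  This brings the quantifiers down to \<open>\<forall>\<exists>\<close>.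
\<close>

definition opt_choice :: "nat \<Rightarrow> nat \<Rightarrow> nat \<Rightarrow> nat \<Rightarrow> nat \<Rightarrow> bool" where
  "opt_choice t c k u n \<longleftrightarrow> (\<exists>a::'a. k = to_nat a) \<and>
     (valid_code TYPE('a \<times> 'e) c \<longrightarrow> snd (prod_decode u) \<le> n \<and>
       (\<forall>b::'a. fst (prod_decode u) * q t c (to_nat b) n \<le> fst (prod_decode u) * q t c k n + 2 ^ n))"

text \<open>A truly best action passes every test: the slack \<open>2 ^ n\<close>, which is 1 after
  scaling, makes the limit inequality strict, so it holds at all late stages. In \<open>u\<close>,
  the first component is the reciprocal of the tolerance, the second the stage to be
  reached.\<close>

lemma ex_opt_choice: "\<exists>k. \<forall>u. \<exists>n. opt_choice t c k u n"
proof (cases "\<exists>h :: ('a, 'e) history. c = hist_code h")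
  case True
  then obtain h :: "('a, 'e) history" where h: "c = hist_code h" by blast
  obtain a where a: "\<And>b. Q t h b \<le> Q t h a" using ex_best by blast
  have "\<exists>n. opt_choice t c (to_nat a) u n" for u
  proof -
    define M where "M = fst (prod_decode u)"
    have "\<forall>\<^sub>F n in sequentially. M * q t c (to_nat b) n \<le> M * q t c (to_nat a) n + 2 ^ n" for b :: 'a
    proof -
      have "(\<lambda>n. real M * (real (q t c (to_nat b) n) / 2 ^ n) - real M * (real (q t c (to_nat a) n) / 2 ^ n))
         \<longlonglongrightarrow> real M * Q t h b - real M * Q t h a"
        unfolding h by (intro tendsto_intros tendsto_q)
      moreover have "real M * Q t h b \<le> real M * Q t h a" by (intro mult_left_mono a) auto
      then have "real M * Q t h b - real M * Q t h a < 1" by linarith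
      ultimately have "\<forall>\<^sub>F n in sequentially. real M * (real (q t c (to_nat b) n) / 2 ^ n)
          - real M * (real (q t c (to_nat a) n) / 2 ^ n) < 1"
        by (rule order_tendstoD(2))
      then show ?thesis
      proof eventually_elim
        case (elim n)
        then have "real M * real (q t c (to_nat b) n) \<le> real M * real (q t c (to_nat a) n) + 2 ^ n"
          by (simp add: field_simps)
        then have "real (M * q t c (to_nat b) n) \<le> real (M * q t c (to_nat a) n + 2 ^ n)" by simp
        then show ?case by (simp only: of_nat_le_iff)
      qed
    qed
    then have "\<forall>\<^sub>F n in sequentially. \<forall>b::'a. M * q t c (to_nat b) n \<le> M * q t c (to_nat a) n + 2 ^ n"
      by (rule eventually_all_finite)
    then obtain N where "\<And>n. n \<ge> N \<Longrightarrow> \<forall>b::'a. M * q t c (to_nat b) n \<le> M * q t c (to_nat a) n + 2 ^ n"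
      unfolding eventually_sequentially by blast
    then show ?thesis unfolding opt_choice_def M_def
      by (intro exI[of _ "max N (snd (prod_decode u))"]) auto
  qed
  then show ?thesis by blast
next
  case False
  then have "\<not> valid_code TYPE('a \<times> 'e) c" unfolding valid_code_iff by blast
  then have "opt_choice t c (to_nat (undefined :: 'a)) u n" for u n
    unfolding opt_choice_def by auto
  then show ?thesis by blast
qed

lemma optimal_policies:
  "\<exists>\<pi>. delta0 3 (policies_graph \<pi>) \<and>
    (\<forall>t h. \<rho> h > 0 \<longrightarrow> V (\<pi> t) (m t) h = opt_value V (m t) h)"
proof -
  define \<kappa> where "\<kappa> t c = (LEAST k. \<forall>u. \<exists>n. opt_choice t c k u n)" for t c
  define \<pi> where "\<pi> t (h :: ('a, 'e) history) = (from_nat (\<kappa> t (hist_code h)) :: 'a)" for t h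
  have y: "\<exists>n. opt_choice t c (\<kappa> t c) u n" for t c u
    using LeastI_ex[OF ex_opt_choice[of t c]] unfolding \<kappa>_def by blast
  have \<kappa>: "\<exists>a::'a. \<kappa> t c = to_nat a" for t c using y[of t c] unfolding opt_choice_def by blast
  then have \<kappa>_eq: "\<kappa> t (hist_code h) = to_nat (\<pi> t h)" for t h unfolding \<pi>_def by (metis from_nat_to_nat)
  have "delta0 3 (policies_graph \<pi>)"
  proof (rule delta0_3_Least)
    show "computable_pred4 (\<lambda>z. opt_choice (fst (prod_decode z)) (fst (prod_decode (snd (prod_decode z)))))"
      unfolding opt_choice_def
      by (intro computable_intros)
    show "\<exists>y. \<forall>u. \<exists>n. opt_choice (fst (prod_decode z)) (fst (prod_decode (snd (prod_decode z)))) y u n" for z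
      by (rule ex_opt_choice)
    let ?F = "\<lambda>z y. valid_code TYPE('a \<times> 'e) (fst (prod_decode (snd (prod_decode z)))) \<and>
       y = snd (prod_decode (snd (prod_decode z)))"
    show "computable_pred2 ?F" by (intro computable_intros)
    show "z \<in> policies_graph \<pi> \<longleftrightarrow> ?F z (LEAST y. \<forall>u. \<exists>n. opt_choice (fst (prod_decode z))
        (fst (prod_decode (snd (prod_decode z)))) y u n)" for z
      using policies_graph_iff[where \<kappa> = \<kappa> and 'e = 'e, OF \<kappa>, of z] unfolding \<pi>_def[abs_def] \<kappa>_def .
  qed
  moreover have "V (\<pi> t) (m t) h = opt_value V (m t) h" if "\<rho> h > 0" for t h
  proof -
    have "Q t h b \<le> Q t h (\<pi> t h)" for h b
    proof (rule field_le_epsilon)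
      fix \<epsilon> :: real assume "\<epsilon> > 0"
      then obtain M where M: "inverse (real (Suc M)) < \<epsilon>" using reals_Archimedean by blast
      have "\<exists>n\<ge>N. Suc M * q t (hist_code h) (to_nat b) n \<le> Suc M * q t (hist_code h) (to_nat (\<pi> t h)) n + 2 ^ n" for N
        using y[of t "hist_code h" "prod_encode (Suc M, N)"] valid_code_iff[where 'a = 'a and 'e = 'e]
        unfolding opt_choice_def \<kappa>_eq by auto
      then obtain N where N: "\<And>k. N k \<ge> k"
          "\<And>k. Suc M * q t (hist_code h) (to_nat b) (N k) \<le> Suc M * q t (hist_code h) (to_nat (\<pi> t h)) (N k) + 2 ^ N k"
        by metis
      have lim: "filterlim N sequentially sequentially"
        by (rule filterlim_at_top_mono[OF filterlim_ident]) (simp add: N(1))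
      have "real (Suc M) * Q t h b \<le> real (Suc M) * Q t h (\<pi> t h) + 1"
      proof (rule LIMSEQ_le)
        show "(\<lambda>k. real (Suc M) * (real (q t (hist_code h) (to_nat b) (N k)) / 2 ^ N k)) \<longlonglongrightarrow> real (Suc M) * Q t h b"
          by (intro tendsto_intros filterlim_compose[OF tendsto_q lim])
        show "(\<lambda>k. real (Suc M) * (real (q t (hist_code h) (to_nat (\<pi> t h)) (N k)) / 2 ^ N k) + 1)
            \<longlonglongrightarrow> real (Suc M) * Q t h (\<pi> t h) + 1"
          by (intro tendsto_intros filterlim_compose[OF tendsto_q lim])
        have "real (Suc M) * (real (q t (hist_code h) (to_nat b) (N k)) / 2 ^ N k)
          \<le> real (Suc M) * (real (q t (hist_code h) (to_nat (\<pi> t h)) (N k)) / 2 ^ N k) + 1" for k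
          using divide_right_mono[OF of_nat_mono[OF N(2)[of k], where 'a = real], of "2 ^ N k"]
          by (simp add: add_divide_distrib del: of_nat_Suc mult_Suc)
        then show "\<exists>N'. \<forall>k\<ge>N'. real (Suc M) * (real (q t (hist_code h) (to_nat b) (N k)) / 2 ^ N k)
          \<le> real (Suc M) * (real (q t (hist_code h) (to_nat (\<pi> t h)) (N k)) / 2 ^ N k) + 1" by blast
      qed
      then have "Q t h b \<le> Q t h (\<pi> t h) + inverse (real (Suc M))" by (simp add: field_simps)
      then show "Q t h b \<le> Q t h (\<pi> t h) + \<epsilon>" using M by linarith
    qed
    then have "Q t h b \<le> Q t h (\<pi> t h) + 0 * \<rho> h" for h b by simp
    from opt_value_le[OF that order_refl this] show ?thesis by simp
  qed
  ultimately show ?thesis by blast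
qed

end

section \<open>Approximation of semicomputable functions and of the entropy\<close>

lemma computable_pred2_if_computable_rel:
  assumes "computable_rel 2 R"
  shows "computable_pred2 (\<lambda>x k. R [x, k])"
proof -
  obtain f where f: "general_recursive 2 f" "\<And>xs. length xs = 2 \<Longrightarrow> R xs \<longleftrightarrow> f xs = 0"
    using assms unfolding computable_rel_def by blast
  let ?gs = "[\<lambda>xs. fst (prod_decode (xs ! 0)), \<lambda>xs. snd (prod_decode (xs ! 0))]"
  have "grec 1 (\<lambda>xs. f (map (\<lambda>g. g xs) ?gs))"
    by (rule grec_comp) (use f(1) in \<open>auto simp: grec_def[of 2] numeral_2_eq_2[symmetric]
        intro!: grec_prod_decode grec_proj\<close>)
  then have "computable_fun (\<lambda>x. f [fst (prod_decode x), snd (prod_decode x)])"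
    unfolding computable_fun_iff_grec by simp
  then have "computable_pred (\<lambda>x. f [fst (prod_decode x), snd (prod_decode x)] = 0)"
    by (intro computable_intros)
  then show ?thesis unfolding computable_pred2_def using f(2) by simp
qed

lemma rat_of_code_nat: "real_of_rat (rat_of_code (prod_encode (2 * p, s))) = real p / real (Suc s)"
  by (simp add: rat_of_code_def int_decode_def sum_decode_def of_rat_divide del: of_nat_Suc)

lemma real_div_Suc:
  "real (a div Suc b) \<le> real a / real (Suc b)" "real a / real (Suc b) < real (a div Suc b) + 1"
proof -
  have "a div Suc b * Suc b \<le> a" "a < Suc (a div Suc b) * Suc b"
    using div_times_less_eq_dividend[of a "Suc b"] dividend_less_div_times[of "Suc b" a]
    by (simp_all only: mult_Suc zero_less_Suc simp_thms)
  then have "real (a div Suc b) * real (Suc b) \<le> real a" "real a < real (Suc (a div Suc b)) * real (Suc b)"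
    unfolding of_nat_mult[symmetric] of_nat_le_iff of_nat_less_iff .
  then show "real (a div Suc b) \<le> real a / real (Suc b)" "real a / real (Suc b) < real (a div Suc b) + 1"
    by (simp_all add: pos_le_divide_eq pos_divide_less_eq add.commute)
qed

text \<open>Stage \<open>n\<close> takes the largest among the first fractions that the enumeration
  confirms within its first \<open>n + 1\<close> steps, rounded down to a multiple of
  \<open>1 / 2 ^ n\<close>. Rounding keeps it a lower bound and costs less than
  \<open>1 / 2 ^ n\<close>.\<close>

lemma lower_semicomputable_approx:
  assumes f: "lower_semicomputable code f" and code: "inj code" and range: "\<And>x. 0 \<le> f x" "\<And>x. f x \<le> 1"
  obtains L where "computable_fun2 L" "\<And>n x. real (L n (code x)) / 2 ^ n \<le> f x"
    "\<And>x. (\<lambda>n. real (L n (code x)) / 2 ^ n) \<longlonglongrightarrow> f x"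
proof -
  obtain R where R: "computable_rel (Suc 1) R"
      "\<And>x. x \<in> {prod_encode (code x, c) | x c. of_rat (rat_of_code c) < f x} \<longleftrightarrow> alternating True 1 R [x]"
    using f unfolding lower_semicomputable_def sigma0_def by blast
  define E where "E x k \<longleftrightarrow> R [x, k]" for x k
  have E: "computable_pred2 E"
    using computable_pred2_if_computable_rel R(1) unfolding E_def[abs_def] by (simp add: numeral_2_eq_2)
  have E_iff: "(\<exists>k. E (prod_encode (code x, c)) k) \<longleftrightarrow> real_of_rat (rat_of_code c) < f x" for x c
    using R(2)[of "prod_encode (code x, c)"] code unfolding E_def by (auto simp: inj_eq)
  \<comment> \<open>The fraction \<open>p / Suc s\<close> has the code
    \<open>prod_encode (2 * p, s)\<close>, as even numbers code nonnegative integers. The default 0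
    is a lower bound because \<open>f\<close> is nonnegative.\<close>
  define v where "v n z j = (if \<exists>k<Suc n. E (prod_encode (z, prod_encode (2 * fst (prod_decode j), snd (prod_decode j)))) k
      then (2 ^ n * fst (prod_decode j)) div Suc (snd (prod_decode j)) else 0)" for n z j :: nat
  define L where "L n z = Max (v n z ` {..n})" for n z
  have cL: "computable_fun2 L"
    unfolding L_def v_def by (intro computable_intros computable_pred2_compose[OF E])
  have v_le: "real (v n (code x) j) / 2 ^ n \<le> f x" for n x j
  proof (cases "v n (code x) j = 0")
    case False
    let ?p = "fst (prod_decode j)" and ?s = "snd (prod_decode j)"
    from False have "\<exists>k. E (prod_encode (code x, prod_encode (2 * ?p, ?s))) k"
      and v: "v n (code x) j = (2 ^ n * ?p) div Suc ?s"
      unfolding v_def by (auto split: if_splits)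
    then have "real ?p / real (Suc ?s) < f x" unfolding E_iff rat_of_code_nat by blast
    moreover have "real (v n (code x) j) \<le> 2 ^ n * (real ?p / real (Suc ?s))"
      unfolding v using real_div_Suc(1)[of "2 ^ n * ?p" ?s] by simp
    then have "real (v n (code x) j) / 2 ^ n \<le> real ?p / real (Suc ?s)"
      by (simp only: pos_divide_le_eq zero_less_power zero_less_numeral mult.commute)
    ultimately show ?thesis by linarith
  qed (use range in simp)
  have le: "real (L n (code x)) / 2 ^ n \<le> f x" for n x
  proof -
    have "L n (code x) \<in> v n (code x) ` {..n}" unfolding L_def by (intro Max_in) auto
    then show ?thesis using v_le by auto
  qed
  have "(\<lambda>n. real (L n (code x)) / 2 ^ n) \<longlonglongrightarrow> f x" for x
  proof (rule order_tendstoI)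
    fix a assume "f x < a"
    then show "\<forall>\<^sub>F n in sequentially. real (L n (code x)) / 2 ^ n < a"
      by (intro always_eventually allI) (rule le_less_trans[OF le])
  next
    fix a assume a: "a < f x"
    show "\<forall>\<^sub>F n in sequentially. a < real (L n (code x)) / 2 ^ n"
    proof (cases "a < 0")
      case True
      then show ?thesis by (auto intro!: always_eventually less_le_trans[OF True])
    next
      case False
      obtain q where q: "q \<in> \<rat>" "a < q" "q < f x" using Rats_dense_in_real[OF a] by blast
      obtain p s' where ps': "s' \<noteq> 0" "\<bar>q\<bar> = real p / real s'" using Rats_abs_nat_div_natE[OF q(1)] by blast
      obtain s where s: "s' = Suc s" using ps'(1) by (cases s') auto
      have qps: "q = real p / real (Suc s)" using ps' s q(2) False by simp
      define j where "j = prod_encode (p, s)"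
      obtain k where k: "E (prod_encode (code x, prod_encode (2 * p, s))) k"
        using E_iff[of x "prod_encode (2 * p, s)"] q(3) unfolding rat_of_code_nat qps by blast
      have "(\<lambda>n. (1 / 2) ^ n :: real) \<longlonglongrightarrow> 0" by (rule LIMSEQ_realpow_zero) auto
      then have "\<forall>\<^sub>F n in sequentially. (1 / 2) ^ n < q - a"
        by (rule order_tendstoD(2)) (use q in simp)
      then show ?thesis using eventually_ge_at_top[of "max j k"]
      proof eventually_elim
        case (elim n)
        have v: "v n (code x) j = (2 ^ n * p) div Suc s"
          unfolding v_def j_def using k elim(2) by (auto simp: less_Suc_eq_le)
        have "v n (code x) j \<le> L n (code x)" unfolding L_def by (intro Max_ge) (use elim in auto)
        moreover have "2 ^ n * q - 1 < real (v n (code x) j)"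
        proof -
          have "real (2 ^ n * p) / real (Suc s) < real ((2 ^ n * p) div Suc s) + 1" by (rule real_div_Suc)
          then show ?thesis unfolding v qps by simp
        qed
        ultimately have "q * 2 ^ n - 1 < real (L n (code x))" unfolding mult.commute[of q] by linarith
        then have "q - (1 / 2) ^ n < real (L n (code x)) / 2 ^ n"
          by (subst pos_less_divide_eq) (simp_all add: left_diff_distrib power_one_over)
        then show ?case using elim(1) by linarith
      qed
    qed
  qed
  then show ?thesis using that cL le by blast
qed

section \<open>The entropy function and its integer approximation\<close>

definition ent :: "real \<Rightarrow> real" where
  "ent x = - x * log 2 x"

lemma ln_2_ge_half: "1 / 2 \<le> ln (2::real)"
  using ln_le_minus_one[of "1 / 2 :: real"] by (simp add: ln_div)

lemma ent_0 [simp]: "ent 0 = 0"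
  by (simp add: ent_def)

lemma ent_nonneg: "0 \<le> x \<Longrightarrow> x \<le> 1 \<Longrightarrow> 0 \<le> ent x"
  by (cases "x = 0") (auto simp: ent_def mult_nonneg_nonpos)

lemma ent_le_2:
  assumes "0 \<le> x" "x \<le> 1" shows "ent x \<le> 2"
proof (cases "x = 0")
  case False
  then have x: "x > 0" using assms by simp
  have "ln (1 / x) \<le> 1 / x - 1" using x by (intro ln_le_minus_one) simp
  then have "x * ln (1 / x) \<le> 1" using x by (simp add: field_simps)
  then have "- x * ln x \<le> 1" using x by (simp add: ln_div)
  then have "- x * ln x \<le> 2 * ln 2" using ln_2_ge_half by linarith
  then show ?thesis by (simp add: ent_def log_def field_simps)
qed simp

text \<open>With \<open>s = sqrt x\<close>, the bound \<open>- ln s \<le> 1 / s\<close> gives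
  \<open>- x * ln x \<le> 2 * s\<close>, and passing to base 2 costs at most another factor 2. This
  yields continuity of \<open>ent\<close> at 0, where the logarithm has no limit.\<close>

lemma ent_le_sqrt:
  assumes "0 \<le> x" "x \<le> 1" shows "ent x \<le> 4 * sqrt x"
proof (cases "x = 0")
  case False
  then have x: "x > 0" using assms by simp
  define s where "s = sqrt x"
  have s: "s > 0" "x = s * s" using x by (auto simp: s_def)
  have "ln (1 / s) \<le> 1 / s - 1" using s by (intro ln_le_minus_one) simp
  then have "- ln s \<le> 1 / s" using s by (simp add: ln_div)
  then have "- (2 * ln s) \<le> 2 / s" by simp
  then have "s * s * - (2 * ln s) \<le> s * s * (2 / s)" using s by (intro mult_left_mono) auto
  then have "- x * ln x \<le> 2 * s" using s by (simp add: ln_mult)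
  also have "\<dots> \<le> (2 * s) * (2 * ln 2)" using ln_2_ge_half s mult_left_mono[of 1 "2 * ln 2" "2 * s"] by simp
  finally show ?thesis by (simp add: ent_def log_def s_def[symmetric] field_simps)
qed simp

lemma tendsto_ent:
  assumes X: "X \<longlonglongrightarrow> x" and X0: "\<And>n. 0 \<le> X n"
  shows "(\<lambda>n. ent (X n)) \<longlonglongrightarrow> ent x"
proof (cases "x = 0")
  case True
  have "(\<lambda>n. 4 * sqrt (X n)) \<longlonglongrightarrow> 4 * sqrt x" by (intro tendsto_intros X)
  then have lim: "(\<lambda>n. 4 * sqrt (X n)) \<longlonglongrightarrow> 0" using True by simp
  have ev: "\<forall>\<^sub>F n in sequentially. X n < 1" using X True by (intro order_tendstoD) auto
  have "(\<lambda>n. ent (X n)) \<longlonglongrightarrow> 0"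
    by (rule tendsto_sandwich[OF _ _ tendsto_const lim])
      (use ev X0 in \<open>auto elim!: eventually_mono intro: ent_nonneg ent_le_sqrt\<close>)
  then show ?thesis using True by simp
next
  case False
  moreover have "0 \<le> x" by (rule LIMSEQ_le_const[OF X]) (use X0 in auto)
  ultimately show ?thesis unfolding ent_def by (intro tendsto_intros X) auto
qed

text \<open>
  Dividing \<open>\<lfloor>log\<^sub>2 (p\<^bsup>n+1\<^esup>)\<rfloor>\<close> by \<open>n + 1\<close> approximates \<open>log\<^sub>2 p\<close> up to \<open>1 / (n + 1)\<close>.
\<close>

definition ent_code :: "nat \<Rightarrow> nat \<Rightarrow> nat" where
  "ent_code n p = min p (2 ^ n) * (n * Suc n - (LEAST k. min p (2 ^ n) ^ Suc n < 2 ^ Suc k)) div Suc n"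

lemma computable_fun_ent_code [computable_intros]:
  assumes "computable_fun f" "computable_fun g"
  shows "computable_fun (\<lambda>x. ent_code (f x) (g x))"
proof -
  have "\<exists>k. min (g x) (2 ^ f x) ^ Suc (f x) < 2 ^ Suc k" for x
    by (rule exI[of _ "min (g x) (2 ^ f x) ^ Suc (f x)"])
      (meson less_exp lessI less_trans power_strict_increasing_iff one_less_numeral_iff semiring_norm(76))
  then show ?thesis unfolding ent_code_def
    by (intro computable_intros assms computable_fun_compose[OF assms(1)] computable_fun_compose[OF assms(2)])
qed

text \<open>Writing \<open>ent (p / 2 ^ n)\<close> as \<open>p / 2 ^ n * (n - log 2 p)\<close>, the
  first error comes from replacing \<open>log 2 p\<close> by \<open>k / Suc n\<close>, the second
  from rounding the numerator down.\<close>

lemma ent_code_approx: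
  assumes p: "p \<le> 2 ^ n"
  shows "\<bar>real (ent_code n p) / 2 ^ n - ent (real p / 2 ^ n)\<bar> \<le> 1 / real (Suc n) + 1 / 2 ^ n"
proof (cases "p = 0")
  case False
  then have p0: "real p > 0" by simp
  define k where "k = (LEAST k. p ^ Suc n < 2 ^ Suc k)"
  define K where "K = n * Suc n - k"
  define N where "N = real (Suc n)"
  have N: "N > 0" by (simp add: N_def)
  have code: "ent_code n p = p * K div Suc n" using p by (simp add: ent_code_def K_def k_def min_absorb1)
  have ub: "p ^ Suc n < 2 ^ Suc k"
    unfolding k_def by (rule LeastI[of _ "p ^ Suc n"])
      (meson less_exp lessI less_trans power_strict_increasing_iff one_less_numeral_iff semiring_norm(76))
  have lb: "2 ^ k \<le> p ^ Suc n"
  proof (cases k)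
    case (Suc j)
    then have "\<not> p ^ Suc n < 2 ^ Suc j" unfolding k_def using not_less_Least by (metis lessI)
    then show ?thesis using Suc by simp
  qed (use False in simp)
  \<comment> \<open>Makes the truncated subtraction in \<open>K\<close> exact.\<close>
  have "k \<le> n * Suc n"
  proof -
    have "(2::nat) ^ k \<le> (2 ^ n) ^ Suc n" using lb power_mono[OF p, of "Suc n"] by linarith
    then show ?thesis unfolding power_mult[symmetric] by simp
  qed
  then have K: "real K = n * N - k" by (simp add: K_def N_def of_nat_diff algebra_simps)
  have log_p: "log 2 (real p ^ Suc n) = N * log 2 p" unfolding N_def by (rule log_nat_power[OF less_imp_le[OF p0]])
  have real_le: "a \<le> b \<Longrightarrow> real a \<le> real b" for a b by simp
  have "2 ^ k \<le> real p ^ Suc n" using real_le[OF lb] by (simp only: of_nat_power of_nat_numeral)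
  then have "real k \<le> N * log 2 p"
    unfolding log_p[symmetric] by (rule le_log_of_power) simp
  moreover have "real p ^ Suc n \<le> 2 ^ Suc k"
    using real_le[OF less_imp_le[OF ub]] by (simp only: of_nat_power of_nat_numeral)
  then have "N * log 2 p \<le> real (Suc k)"
    unfolding log_p[symmetric] using log_mono[of 2 "real p ^ Suc n" "2 ^ Suc k"] p0
      log_pow_cancel[of 2 "Suc k"] by (simp del: power_Suc)
  ultimately have "log 2 p \<le> (real k + 1) / N" and k2: "real k / N \<le> log 2 p"
    using N by (simp_all add: pos_le_divide_eq pos_divide_le_eq mult.commute)
  then have k: "log 2 p - 1 / N \<le> real k / N" "real k / N \<le> log 2 p"
    by (simp_all add: add_divide_distrib)
  define y where "y = real p / 2 ^ n"
  have "real p \<le> 2 ^ n" using real_le[OF p] by (simp only: of_nat_power of_nat_numeral)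
  then have y: "0 < y" "y \<le> 1" using p0 by (simp_all add: y_def)
  have ent_y: "ent y = y * (n - log 2 p)"
    using p0 by (simp add: ent_def y_def log_divide log_nat_power field_simps)
  have real_K: "real K / N = n - k / N" using N by (simp add: K field_simps)
  have "real (p * K) / N < real (ent_code n p) + 1"
    unfolding code N_def by (rule real_div_Suc)
  moreover have "real (ent_code n p) \<le> real (p * K) / N"
    unfolding code N_def by (rule real_div_Suc)
  moreover have "real (p * K) / N = real p * (n - k / N)" unfolding real_K[symmetric] by simp
  ultimately have c: "real p * (n - k / N) - 1 \<le> real (ent_code n p)" "real (ent_code n p) \<le> real p * (n - k / N)"
    by linarith+
  have "y * (n - k / N) - 1 / 2 ^ n \<le> real (ent_code n p) / 2 ^ n" "real (ent_code n p) / 2 ^ n \<le> y * (n - k / N)"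
    using divide_right_mono[OF c(1), of "2 ^ n"] divide_right_mono[OF c(2), of "2 ^ n"]
    by (simp_all add: y_def diff_divide_distrib)
  moreover have "y * (n - log 2 p) \<le> y * (n - k / N)" using k y by (intro mult_left_mono) auto
  moreover have "y * (n - k / N) \<le> y * (n - log 2 p) + 1 / N"
  proof -
    have "y * (n - k / N) \<le> y * (n - log 2 p + 1 / N)" using k y by (intro mult_left_mono) auto
    also have "\<dots> \<le> y * (n - log 2 p) + 1 * (1 / N)" unfolding distrib_left using y N
      by (intro add_left_mono mult_right_mono) auto
    finally show ?thesis by simp
  qed
  moreover have "0 \<le> 1 / N" "0 \<le> 1 / (2 ^ n :: real)" using N by auto
  ultimately show ?thesis unfolding y_def[symmetric] ent_y N_def[symmetric] abs_le_iff by linarith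
qed (simp add: ent_code_def)

lemma tendsto_half_power: "(\<lambda>n. 1 / 2 ^ n :: real) \<longlonglongrightarrow> 0"
  using LIMSEQ_realpow_zero[of "1 / 2 :: real"] by (simp add: power_one_over)

lemma ent_code_min: "ent_code n p = ent_code n (min p (2 ^ n))"
  by (simp add: ent_code_def)

lemma tendsto_ent_code:
  assumes p: "(\<lambda>n. real (p n) / 2 ^ n) \<longlonglongrightarrow> x" and x: "x \<le> 1"
  shows "(\<lambda>n. real (ent_code n (p n)) / 2 ^ n) \<longlonglongrightarrow> ent x"
proof -
  let ?y = "\<lambda>n. real (min (p n) (2 ^ n)) / 2 ^ n"
  have y: "?y \<longlonglongrightarrow> x"
  proof -
    have "?y = (\<lambda>n. min (real (p n) / 2 ^ n) 1)" by (auto simp: min_def fun_eq_iff field_simps)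
    moreover have "(\<lambda>n. min (real (p n) / 2 ^ n) 1) \<longlonglongrightarrow> min x 1" by (intro tendsto_min p tendsto_const)
    ultimately show ?thesis using x by (simp add: min_absorb1)
  qed
  have "(\<lambda>n. real (ent_code n (p n)) / 2 ^ n - ent (?y n)) \<longlonglongrightarrow> 0"
  proof (rule Lim_null_comparison)
    show "\<forall>\<^sub>F n in sequentially. norm (real (ent_code n (p n)) / 2 ^ n - ent (?y n)) \<le> 1 / real (Suc n) + 1 / 2 ^ n"
      using ent_code_approx[of "min (p n) (2 ^ n)" n for n] by (simp add: ent_code_min[symmetric])
    have "(\<lambda>n. 1 / real (Suc n) + 1 / 2 ^ n) \<longlonglongrightarrow> 0 + 0"
      using LIMSEQ_inverse_real_of_nat tendsto_half_power by (intro tendsto_add) (simp_all add: inverse_eq_divide)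
    then show "(\<lambda>n. 1 / real (Suc n) + 1 / 2 ^ n) \<longlonglongrightarrow> 0" by simp
  qed
  from tendsto_add[OF this tendsto_ent[OF y]] show ?thesis by simp
qed

text \<open>The cap at \<open>2 ^ n\<close> inside \<open>ent_code\<close> makes the bound uniform
  in \<open>n\<close> and \<open>p\<close>, as dominated convergence needs; 4 is the bound 2 on
  \<open>ent\<close> plus two errors of at most 1.\<close>

lemma ent_code_le: "real (ent_code n p) / 2 ^ n \<le> 4"
proof -
  let ?y = "real (min p (2 ^ n)) / 2 ^ n"
  have "real (ent_code n p) / 2 ^ n \<le> ent ?y + (1 / real (Suc n) + 1 / 2 ^ n)"
    using ent_code_approx[of "min p (2 ^ n)" n] by (simp add: ent_code_min[symmetric])
  moreover have "ent ?y \<le> 2" by (rule ent_le_2) (auto simp: min_def field_simps)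
  moreover have "1 / real (Suc n) \<le> 1" "1 / 2 ^ n \<le> (1::real)" by auto
  ultimately show ?thesis by linarith
qed

section \<open>The Bayes mixture\<close>

text \<open>With the actions of \<open>h\<close> fixed, a percept string other than that of
  \<open>h\<close> leaves it first at exactly one position \<open>j\<close>. Removing the mass of
  these branches from the total mass 1 leaves \<open>\<rho> h\<close>.\<close>

lemma chron_measure_eq_compl:
  assumes "\<rho> [] = 1" and sum: "\<And>h a. (\<Sum>e\<in>UNIV. \<rho> (h @ [(a, e)])) = (\<rho> h :: real)"
  shows "\<rho> h = 1 - (\<Sum>j<length h. \<Sum>e\<in>UNIV. if e = snd (h ! j) then 0
      else \<rho> (take j h @ [(fst (h ! j), e :: 'e::finite)]))"
proof (induction h rule: rev_induct)
  case (snoc x h)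
  obtain a e where x: "x = (a, e)" by (cases x)
  have "(\<Sum>e'\<in>UNIV. if e' = e then 0 else \<rho> (h @ [(a, e')])) = \<rho> h - \<rho> (h @ [(a, e)])"
  proof -
    have "(\<Sum>e'\<in>UNIV. if e' = e then 0 else \<rho> (h @ [(a, e')])) =
      (\<Sum>e'\<in>UNIV. \<rho> (h @ [(a, e')]) - (if e' = e then \<rho> (h @ [(a, e')]) else 0))"
      by (rule sum.cong) auto
    then show ?thesis by (simp add: sum_subtractf sum)
  qed
  moreover have "(\<Sum>j<length h. \<Sum>e'\<in>UNIV. if e' = snd ((h @ [x]) ! j) then 0
      else \<rho> (take j (h @ [x]) @ [(fst ((h @ [x]) ! j), e')])) =
    (\<Sum>j<length h. \<Sum>e'\<in>UNIV. if e' = snd (h ! j) then 0 else \<rho> (take j h @ [(fst (h ! j), e')]))"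
    by (rule sum.cong) (auto simp: nth_append cong: if_cong)
  ultimately show ?case using snoc by (simp add: x cong: if_cong)
qed (simp add: assms)

locale universal_mixture =
  fixes \<nu>s :: "nat \<Rightarrow> ('a::finite, 'e::finite) env"
    and M :: "('a, 'e) env set" and w :: "('a, 'e) env \<Rightarrow> real" and \<xi> :: "('a, 'e) env"
  assumes M: "M = range \<nu>s"
    and semimeasures: "\<And>\<nu>. \<nu> \<in> M \<Longrightarrow> chron_semimeasure \<nu>"
    and lsc: "uniformly_lower_semicomputable \<nu>s"
    and prior: "positive_prior M w"
    and prior_lsc: "lower_semicomputable (\<lambda>i. i) (\<lambda>i. w (\<nu>s i))"
    and \<xi>: "\<xi> = mixture w M"
    and measure: "chron_measure \<xi>"
begin

text \<open>The prior expectation over environments. Since the prior is summable, boundedness on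
  \<open>M\<close> settles all questions of convergence.\<close>

definition W :: "(('a, 'e) env \<Rightarrow> real) \<Rightarrow> real" where
  "W f = (\<Sum>\<^sub>\<infinity>\<nu>\<in>M. w \<nu> * f \<nu>)"

definition bounded_on_M :: "(('a, 'e) env \<Rightarrow> real) \<Rightarrow> bool" where
  "bounded_on_M f \<longleftrightarrow> (\<exists>B. \<forall>\<nu>\<in>M. \<bar>f \<nu>\<bar> \<le> B)"

lemma bounded_on_MI: "(\<And>\<nu>. \<nu> \<in> M \<Longrightarrow> \<bar>f \<nu>\<bar> \<le> B) \<Longrightarrow> bounded_on_M f"
  unfolding bounded_on_M_def by blast

lemma bounded_on_M_add:
  assumes "bounded_on_M f" "bounded_on_M g" shows "bounded_on_M (\<lambda>\<nu>. f \<nu> + g \<nu>)"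
proof -
  obtain B C where "\<forall>\<nu>\<in>M. \<bar>f \<nu>\<bar> \<le> B" "\<forall>\<nu>\<in>M. \<bar>g \<nu>\<bar> \<le> C" using assms unfolding bounded_on_M_def by blast
  then show ?thesis by (intro bounded_on_MI[of _ "B + C"]) (fastforce intro: order_trans[OF abs_triangle_ineq])
qed

lemma bounded_on_M_cmult: "bounded_on_M f \<Longrightarrow> bounded_on_M (\<lambda>\<nu>. c * f \<nu>)"
  unfolding bounded_on_M_def by (metis abs_ge_zero abs_mult mult_left_mono)

lemma bounded_on_M_const: "bounded_on_M (\<lambda>\<nu>. c)"
  by (rule bounded_on_MI[of _ "\<bar>c\<bar>"]) simp

lemma bounded_on_M_sum: "(\<And>i. i \<in> I \<Longrightarrow> bounded_on_M (f i)) \<Longrightarrow> bounded_on_M (\<lambda>\<nu>. \<Sum>i\<in>I. f i \<nu>)"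
  by (induction I rule: infinite_finite_induct) (auto intro: bounded_on_M_add bounded_on_M_const)

lemma w_pos: "\<nu> \<in> M \<Longrightarrow> 0 < w \<nu>" and w_summable: "w summable_on M" and w_sum: "(\<Sum>\<^sub>\<infinity>\<nu>\<in>M. w \<nu>) \<le> 1"
  using prior unfolding positive_prior_def by auto

lemma W_summable:
  assumes "bounded_on_M f" shows "(\<lambda>\<nu>. w \<nu> * f \<nu>) summable_on M"
proof -
  obtain B where B: "\<And>\<nu>. \<nu> \<in> M \<Longrightarrow> \<bar>f \<nu>\<bar> \<le> B" using assms unfolding bounded_on_M_def by blast
  have "(\<lambda>\<nu>. norm (w \<nu> * f \<nu>)) summable_on M"
  proof (rule abs_summable_on_comparison_test')
    show "(\<lambda>\<nu>. w \<nu> * B) summable_on M" by (intro summable_on_cmult_left w_summable)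
    show "norm (w \<nu> * f \<nu>) \<le> w \<nu> * B" if "\<nu> \<in> M" for \<nu>
      using B[OF that] w_pos[OF that] by (simp add: abs_mult mult_left_mono)
  qed
  then show ?thesis by (rule abs_summable_summable)
qed

lemma W_add: "bounded_on_M f \<Longrightarrow> bounded_on_M g \<Longrightarrow> W (\<lambda>\<nu>. f \<nu> + g \<nu>) = W f + W g"
  unfolding W_def distrib_left by (intro infsum_add W_summable)

lemma W_cmult: "W (\<lambda>\<nu>. c * f \<nu>) = c * W f"
  unfolding W_def by (simp add: infsum_cmult_right'[symmetric] mult.left_commute)

lemma W_diff: "bounded_on_M f \<Longrightarrow> bounded_on_M g \<Longrightarrow> W (\<lambda>\<nu>. f \<nu> - g \<nu>) = W f - W g"
  using W_add[of f "\<lambda>\<nu>. (-1) * g \<nu>"] W_cmult[of "-1" g] bounded_on_M_cmult[of g "-1"] by simp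

lemma W_sum:
  assumes "\<And>i. i \<in> I \<Longrightarrow> bounded_on_M (f i)"
  shows "W (\<lambda>\<nu>. \<Sum>i\<in>I. f i \<nu>) = (\<Sum>i\<in>I. W (f i))"
  using assms
  by (induction I rule: infinite_finite_induct) (auto simp: W_add bounded_on_M_sum, auto simp: W_def)

lemma W_cong: "(\<And>\<nu>. \<nu> \<in> M \<Longrightarrow> f \<nu> = g \<nu>) \<Longrightarrow> W f = W g"
  unfolding W_def by (intro infsum_cong) auto

lemma W_mono:
  assumes "bounded_on_M f" "bounded_on_M g" "\<And>\<nu>. \<nu> \<in> M \<Longrightarrow> f \<nu> \<le> g \<nu>"
  shows "W f \<le> W g"
  unfolding W_def using assms w_pos by (intro infsum_mono W_summable mult_left_mono) (auto intro: less_imp_le)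

text \<open>All prior weights are strictly positive, so a nonnegative function of mean 0 vanishes on
  \<open>M\<close>. This passes properties of \<xi> down to every \<nu>.\<close>

lemma W_eq_0D:
  assumes "W f \<le> 0" "bounded_on_M f" "\<And>\<nu>. \<nu> \<in> M \<Longrightarrow> 0 \<le> f \<nu>" "\<nu> \<in> M"
  shows "f \<nu> = 0"
proof -
  have "w \<nu> * f \<nu> = 0"
    by (rule nonneg_infsum_le_0D[OF _ W_summable[OF assms(2)]])
      (use assms in \<open>auto simp: W_def intro!: mult_nonneg_nonneg less_imp_le[OF w_pos]\<close>)
  then show ?thesis using w_pos[OF assms(4)] by simp
qed

lemma \<nu>_bounds: "\<nu> \<in> M \<Longrightarrow> 0 \<le> \<nu> h" "\<nu> \<in> M \<Longrightarrow> \<nu> h \<le> 1"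
  using chron_semimeasureD(1,2)[OF semimeasures] by blast+

lemma bounded_\<nu>: "bounded_on_M (\<lambda>\<nu>. \<nu> h)"
  by (rule bounded_on_MI[of _ 1]) (use \<nu>_bounds[of _ h] in auto)

lemma \<xi>_eq: "\<xi> h = W (\<lambda>\<nu>. \<nu> h)"
  unfolding \<xi> mixture_def W_def ..

lemma semimeasure_\<xi>: "chron_semimeasure \<xi>" and \<xi>_Nil: "\<xi> [] = 1"
  and sum_\<xi>: "(\<Sum>e\<in>UNIV. \<xi> (h @ [(a, e)])) = \<xi> h"
  using measure unfolding chron_measure_def by auto

text \<open>
  The prior has total mass at most one and \<open>\<xi>\<close> loses no mass, so no \<open>\<nu>\<close> can lose any.
\<close>

lemma \<nu>_Nil:
  assumes "\<nu> \<in> M" shows "\<nu> [] = 1"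
proof -
  have "W (\<lambda>\<nu>. 1 - \<nu> []) = W (\<lambda>\<nu>. 1) - \<xi> []"
    unfolding \<xi>_eq by (intro W_diff bounded_\<nu> bounded_on_M_const)
  then have "W (\<lambda>\<nu>. 1 - \<nu> []) \<le> 0" using w_sum by (simp add: \<xi>_Nil W_def)
  moreover have "bounded_on_M (\<lambda>\<nu>. 1 - \<nu> [])" by (rule bounded_on_MI[of _ 1]) (use \<nu>_bounds[of _ "[]"] in auto)
  ultimately have "1 - \<nu> [] = 0" by (rule W_eq_0D) (use \<nu>_bounds assms in auto)
  then show ?thesis by simp
qed

lemma sum_\<nu>:
  assumes "\<nu> \<in> M" shows "(\<Sum>e\<in>UNIV. \<nu> (h @ [(a, e)])) = \<nu> h"
proof -
  let ?f = "\<lambda>\<nu>. \<nu> h - (\<Sum>e\<in>UNIV. \<nu> (h @ [(a, e)]))"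
  have b: "bounded_on_M (\<lambda>\<nu>. \<Sum>e\<in>UNIV. \<nu> (h @ [(a, e)]))" by (intro bounded_on_M_sum bounded_\<nu>)
  have "W ?f = \<xi> h - (\<Sum>e\<in>UNIV. \<xi> (h @ [(a, e)]))"
    unfolding \<xi>_eq by (simp add: W_diff b bounded_\<nu> W_sum)
  then have "W ?f \<le> 0" by (simp add: sum_\<xi>)
  moreover have "bounded_on_M ?f"
    using bounded_on_M_add[OF bounded_\<nu> bounded_on_M_cmult[OF b, of "-1"]] by simp
  moreover have "0 \<le> ?f \<nu>" if "\<nu> \<in> M" for \<nu>
    using semimeasures[OF that] unfolding chron_semimeasure_def by auto
  ultimately have "?f \<nu> = 0" using assms by (rule W_eq_0D)
  then show ?thesis by simp
qed

lemma \<nu>_eq_compl: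
  assumes "\<nu> \<in> M"
  shows "\<nu> h = 1 - (\<Sum>j<length h. \<Sum>e\<in>UNIV. if e = snd (h ! j) then 0 else \<nu> (take j h @ [(fst (h ! j), e)]))"
  using assms by (intro chron_measure_eq_compl \<nu>_Nil sum_\<nu>)

lemma w_le_1: "\<nu> \<in> M \<Longrightarrow> w \<nu> \<le> 1"
proof -
  assume "\<nu> \<in> M"
  then have "sum w {\<nu>} \<le> (\<Sum>\<^sub>\<infinity>\<nu>\<in>M. w \<nu>)"
    by (intro finite_sum_le_infsum w_summable) (auto intro: less_imp_le w_pos)
  then show ?thesis using w_sum by simp
qed

lemma \<nu>s_in_M [simp]: "\<nu>s i \<in> M"
  by (simp add: M)

lemma \<nu>_eq_0_if_\<xi>_eq_0:
  assumes "\<xi> h = 0" "\<nu> \<in> M" shows "\<nu> h = 0"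
  by (rule W_eq_0D[where f = "\<lambda>\<nu>. \<nu> h"]) (use assms \<xi>_eq[of h] bounded_\<nu> \<nu>_bounds in auto)

text \<open>
  The enumeration may repeat environments, while the mixture counts each of them once.
\<close>

definition fresh :: "nat \<Rightarrow> bool" where
  "fresh i \<longleftrightarrow> (\<forall>j<i. \<nu>s i \<noteq> \<nu>s j)"

lemma bij_betw_fresh: "bij_betw \<nu>s {i. fresh i} M"
  unfolding bij_betw_def
proof
  show "inj_on \<nu>s {i. fresh i}"
    by (rule inj_onI) (metis fresh_def linorder_neqE_nat mem_Collect_eq)
  have "\<nu>s i \<in> \<nu>s ` {i. fresh i}" for i
  proof -
    let ?k = "LEAST k. \<nu>s k = \<nu>s i"
    have "\<nu>s ?k = \<nu>s i" by (rule LeastI[of _ i]) simp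
    moreover have "fresh ?k" unfolding fresh_def using calculation not_less_Least by force
    ultimately show ?thesis by (metis imageI mem_Collect_eq)
  qed
  then show "\<nu>s ` {i. fresh i} = M" unfolding M by auto
qed

text \<open>The approximations are indexed by numbers, so the unordered sum over the set
  \<open>M\<close> is turned into a series over the fresh indices.\<close>

lemma W_eq_suminf:
  assumes "bounded_on_M f"
  shows "summable (\<lambda>i. if fresh i then w (\<nu>s i) * f (\<nu>s i) else 0)"
    "W f = (\<Sum>i. if fresh i then w (\<nu>s i) * f (\<nu>s i) else 0)"
proof -
  have "((\<lambda>\<nu>. w \<nu> * f \<nu>) has_sum W f) M" unfolding W_def by (intro has_sum_infsum W_summable assms)
  then have "((\<lambda>i. w (\<nu>s i) * f (\<nu>s i)) has_sum W f) {i. fresh i}"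
    using has_sum_reindex_bij_betw[OF bij_betw_fresh, of "\<lambda>\<nu>. w \<nu> * f \<nu>" "W f"] by simp
  then have "((\<lambda>i. if fresh i then w (\<nu>s i) * f (\<nu>s i) else 0) has_sum W f) UNIV"
    by (rule iffD1[OF has_sum_cong_neutral, rotated -1]) auto
  then have "(\<lambda>i. if fresh i then w (\<nu>s i) * f (\<nu>s i) else 0) sums W f" by (rule has_sum_imp_sums)
  then show "summable (\<lambda>i. if fresh i then w (\<nu>s i) * f (\<nu>s i) else 0)"
    "W f = (\<Sum>i. if fresh i then w (\<nu>s i) * f (\<nu>s i) else 0)"
    by (auto simp: sums_iff)
qed

end

locale approximated_mixture = universal_mixture \<nu>s M w \<xi>
  for \<nu>s :: "nat \<Rightarrow> ('a::finite, 'e::finite) env" and M w \<xi> +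
  fixes L lw :: "nat \<Rightarrow> nat \<Rightarrow> nat"
  assumes L: "computable_fun2 L" "\<And>n i h. real (L n (prod_encode (i, hist_code h))) / 2 ^ n \<le> \<nu>s i h"
      "\<And>i h. (\<lambda>n. real (L n (prod_encode (i, hist_code h))) / 2 ^ n) \<longlonglongrightarrow> \<nu>s i h"
    and lw: "computable_fun2 lw" "\<And>n i. real (lw n i) / 2 ^ n \<le> w (\<nu>s i)"
      "\<And>i. (\<lambda>n. real (lw n i) / 2 ^ n) \<longlonglongrightarrow> w (\<nu>s i)"

lemma (in universal_mixture) ex_approximated_mixture: "\<exists>L lw. approximated_mixture \<nu>s M w \<xi> L lw"
proof -
  have inj: "inj (\<lambda>(i, h :: ('a, 'e) history). prod_encode (i, hist_code h))"
    by (auto simp: inj_def)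
  obtain L where L: "computable_fun2 L"
      "\<And>n x. real (L n ((\<lambda>(i, h). prod_encode (i, hist_code h)) x)) / 2 ^ n \<le> (\<lambda>(i, h). \<nu>s i h) x"
      "\<And>x. (\<lambda>n. real (L n ((\<lambda>(i, h). prod_encode (i, hist_code h)) x)) / 2 ^ n) \<longlonglongrightarrow> (\<lambda>(i, h). \<nu>s i h) x"
    by (rule lower_semicomputable_approx[OF lsc[unfolded uniformly_lower_semicomputable_def] inj])
      (auto simp: \<nu>_bounds)
  obtain lw where lw: "computable_fun2 lw" "\<And>n i. real (lw n i) / 2 ^ n \<le> w (\<nu>s i)"
      "\<And>i. (\<lambda>n. real (lw n i) / 2 ^ n) \<longlonglongrightarrow> w (\<nu>s i)"
    by (rule lower_semicomputable_approx[OF prior_lsc]) (auto simp: w_le_1 intro!: less_imp_le[OF w_pos])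
  have "approximated_mixture \<nu>s M w \<xi> L lw"
    using L(1) L(2)[of _ "(i, h)" for i h] L(3)[of "(i, h)" for i h] lw
    by unfold_locales auto
  then show ?thesis by blast
qed

context approximated_mixture
begin

text \<open>
  Since each \<open>\<nu>\<close> is a measure, the lower approximations of the percepts that did not occur
  bound \<open>\<nu> h\<close> from above.
\<close>

definition up :: "nat \<Rightarrow> nat \<Rightarrow> nat \<Rightarrow> nat" where
  "up n i c = 2 ^ n - (\<Sum>j<length (list_decode c). \<Sum>e::'e\<in>UNIV.
     if to_nat e = snd (prod_decode (nth_code c j)) then 0
     else L n (prod_encode (i, list_encode (take j (list_decode c) @
       [prod_encode (fst (prod_decode (nth_code c j)), to_nat e)]))))"

lemma computable_fun_up [computable_intros]:
  assumes "computable_fun f1" "computable_fun f2" "computable_fun f3"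
  shows "computable_fun (\<lambda>x. up (f1 x) (f2 x) (f3 x))"
  unfolding up_def
  by (intro computable_intros computable_fun2_compose[OF L(1)] assms computable_fun_compose[OF assms(1)]
      computable_fun_compose[OF assms(2)] computable_fun_compose[OF assms(3)])

lemma up_approx: "\<nu>s i h \<le> real (up n i (hist_code h)) / 2 ^ n"
  "(\<lambda>n. real (up n i (hist_code h)) / 2 ^ n) \<longlonglongrightarrow> \<nu>s i h"
proof -
  let ?l = "\<lambda>n h. real (L n (prod_encode (i, hist_code h))) / 2 ^ n"
  let ?S = "\<lambda>n. \<Sum>j<length h. \<Sum>e\<in>UNIV. if e = snd (h ! j) then 0 else ?l n (take j h @ [(fst (h ! j), e)])"
  let ?T = "\<Sum>j<length h. \<Sum>e\<in>UNIV. if e = snd (h ! j) then 0 else \<nu>s i (take j h @ [(fst (h ! j), e)])"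
  \<comment> \<open>Truncated subtraction appears as a maximum with 0, which leaves the limit alone
    because \<open>\<nu>s i h\<close> is nonnegative.\<close>
  have up: "real (up n i (hist_code h)) / 2 ^ n = max (1 - ?S n) 0" for n
  proof -
    have "nth_code (hist_code h) j = prod_encode (to_nat (fst (h ! j)), to_nat (snd (h ! j)))" if "j < length h" for j
      using that by (simp add: nth_code_def hist_code_def case_prod_unfold)
    moreover have "list_encode (take j (list_decode (hist_code h)) @ [prod_encode (to_nat a, to_nat e)]) =
        hist_code (take j h @ [(a, e)])" for j and a :: 'a and e :: 'e
      by (simp add: hist_code_def take_map)
    ultimately have "up n i (hist_code h) = 2 ^ n - (\<Sum>j<length h. \<Sum>e\<in>UNIV. if e = snd (h ! j) then 0
        else L n (prod_encode (i, hist_code (take j h @ [(fst (h ! j), e)]))))" (is "_ = _ - ?s")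
      unfolding up_def by (auto intro!: arg_cong[where f = "\<lambda>x. 2 ^ n - x"] sum.cong)
    moreover have "real (2 ^ n - s) / 2 ^ n = max (1 - real s / 2 ^ n) 0" for s :: nat
      by (cases "s \<le> 2 ^ n") (auto simp: of_nat_diff diff_divide_distrib max_def divide_le_eq le_divide_eq)
    moreover have "real ?s / 2 ^ n = ?S n"
      by (auto simp: sum_divide_distrib intro!: sum.cong)
    ultimately show ?thesis by simp
  qed
  have T: "\<nu>s i h = max (1 - ?T) 0" using \<nu>_eq_compl[of "\<nu>s i" h] \<nu>_bounds(1)[of "\<nu>s i" h] by simp
  show "\<nu>s i h \<le> real (up n i (hist_code h)) / 2 ^ n"
    unfolding up T by (intro max.mono diff_left_mono sum_mono) (auto simp: L(2))
  have "(\<lambda>n. if e = snd (h ! j) then 0 else ?l n (take j h @ [(fst (h ! j), e)]))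
      \<longlonglongrightarrow> (if e = snd (h ! j) then 0 else \<nu>s i (take j h @ [(fst (h ! j), e)]))" for j e
    by (cases "e = snd (h ! j)") (auto intro: L(3))
  then have "?S \<longlonglongrightarrow> ?T" by (intro tendsto_sum)
  then show "(\<lambda>n. real (up n i (hist_code h)) / 2 ^ n) \<longlonglongrightarrow> \<nu>s i h"
    unfolding up T by (intro tendsto_max tendsto_diff tendsto_const)
qed

text \<open>
  Hence the \<open>\<nu>s\<close> are computable reals, and two distinct ones are eventually told apart.
\<close>

definition differ :: "nat \<Rightarrow> nat \<Rightarrow> nat \<Rightarrow> bool" where
  "differ n i j \<longleftrightarrow> (\<exists>c<n. valid_code TYPE('a \<times> 'e) c \<and>
     (up n j c < L n (prod_encode (i, c)) \<or> up n i c < L n (prod_encode (j, c))))"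

definition seen_fresh :: "nat \<Rightarrow> nat \<Rightarrow> bool" where
  "seen_fresh n i \<longleftrightarrow> (\<forall>j<i. differ n i j)"

lemma computable_pred_seen_fresh [computable_intros]:
  assumes "computable_fun f" "computable_fun g"
  shows "computable_pred (\<lambda>x. seen_fresh (f x) (g x))"
  unfolding seen_fresh_def differ_def
  by (intro computable_intros computable_fun2_compose[OF L(1)] assms computable_fun_compose[OF assms(1)]
      computable_fun_compose[OF assms(2)])

text \<open>A lower bound on one environment above an upper bound on the other is a correct
  certificate at whatever stage it appears.\<close>

lemma differD: "differ n i j \<Longrightarrow> \<nu>s i \<noteq> \<nu>s j"
proof
  assume "differ n i j" and eq: "\<nu>s i = \<nu>s j"
  then obtain h :: "('a, 'e) history" where
    h: "up n j (hist_code h) < L n (prod_encode (i, hist_code h)) \<or> up n i (hist_code h) < L n (prod_encode (j, hist_code h))"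
    unfolding differ_def valid_code_iff by blast
  have "real (L n (prod_encode (k, hist_code h))) / 2 ^ n \<le> real (up n k' (hist_code h)) / 2 ^ n"
    if "\<nu>s k = \<nu>s k'" for k k'
    using L(2)[of n k h] up_approx(1)[of k' h n] unfolding that by (rule order_trans)
  from this[OF eq] this[OF eq[symmetric]] h show False by (auto simp: divide_le_cancel)
qed

lemma eventually_differ:
  assumes "\<nu>s i \<noteq> \<nu>s j" shows "\<forall>\<^sub>F n in sequentially. differ n i j"
proof -
  have *: "\<forall>\<^sub>F n in sequentially. valid_code TYPE('a \<times> 'e) (hist_code h) \<and> hist_code h < n \<and>
      up n j (hist_code h) < L n (prod_encode (i, hist_code h))" if lt: "\<nu>s j h < \<nu>s i h" for i j h
  proof -
    have "\<forall>\<^sub>F n in sequentially. real (up n j (hist_code h)) / 2 ^ n - real (L n (prod_encode (i, hist_code h))) / 2 ^ n < 0"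
      by (rule order_tendstoD(2)[OF tendsto_diff[OF up_approx(2) L(3)]]) (use lt in simp)
    then show ?thesis using eventually_gt_at_top[of "hist_code h"]
      by eventually_elim (auto simp: valid_code_iff divide_less_cancel)
  qed
  obtain h where "\<nu>s i h < \<nu>s j h \<or> \<nu>s j h < \<nu>s i h" using assms by (meson ext linorder_less_linear)
  then show ?thesis unfolding differ_def
    by (elim disjE) (auto dest!: * elim!: eventually_mono)
qed

text \<open>Recognition may be late but is never wrong, so no stage of \<open>mix\<close> counts an
  environment twice.\<close>

lemma seen_freshD: "seen_fresh n i \<Longrightarrow> fresh i"
  unfolding seen_fresh_def fresh_def using differD by blast

lemma eventually_seen_fresh: "fresh i \<Longrightarrow> \<forall>\<^sub>F n in sequentially. seen_fresh n i"
proof -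
  assume "fresh i"
  then have "\<forall>\<^sub>F n in sequentially. \<forall>j\<in>{..<i}. differ n i j"
    by (intro eventually_ball_finite) (auto simp: fresh_def intro: eventually_differ)
  then show ?thesis by (rule eventually_mono) (auto simp: seen_fresh_def)
qed

text \<open>A product of two numerators has denominator \<open>2 ^ n * 2 ^ n\<close>; dividing by
  \<open>2 ^ n\<close> restores the common scale. The divisor is written as a successor to fit
  \<open>computable_fun_div_Suc\<close>.\<close>

definition mix :: "(nat \<Rightarrow> nat \<Rightarrow> nat \<Rightarrow> nat) \<Rightarrow> nat \<Rightarrow> nat \<Rightarrow> nat" where
  "mix F n c = (\<Sum>i<n. if seen_fresh n i then lw n i * F n i c else 0) div Suc (2 ^ n - 1)"

lemma computable_fun_mix:
  assumes "computable_fun3 F"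
  shows "computable_fun2 (mix F)"
  unfolding mix_def by (intro computable_intros computable_fun2_compose[OF lw(1)] computable_fun3_compose[OF assms])

text \<open>Tannery's theorem, i.e. dominated convergence for series: each summand converges since
  freshness is eventually recognised, and the weights of the fresh indices times \<open>B\<close>
  form a summable majorant.\<close>

lemma tendsto_mix:
  assumes F: "\<And>i. (\<lambda>n. real (F n i c) / 2 ^ n) \<longlonglongrightarrow> f (\<nu>s i)"
    and bound: "\<And>n i. real (F n i c) / 2 ^ n \<le> B"
  shows "(\<lambda>n. real (mix F n c) / 2 ^ n) \<longlonglongrightarrow> W f"
proof -
  define a where "a i n = (if i < n \<and> seen_fresh n i then (real (lw n i) / 2 ^ n) * (real (F n i c) / 2 ^ n) else 0)" for i n
  define b where "b i = (if fresh i then w (\<nu>s i) * f (\<nu>s i) else 0)" for i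
  have f0: "0 \<le> f (\<nu>s i)" for i by (rule LIMSEQ_le_const[OF F]) auto
  have fB: "f (\<nu>s i) \<le> B" for i by (rule LIMSEQ_le_const2[OF F]) (use bound in auto)
  have bf: "bounded_on_M f" by (rule bounded_on_MI[of _ B]) (use f0 fB in \<open>auto simp: M\<close>)
  have B0: "0 \<le> B" using f0 fB by (meson order_trans)
  have lim: "(\<lambda>n. a i n) \<longlonglongrightarrow> b i" for i
  proof (cases "fresh i")
    case True
    have "(\<lambda>n. (real (lw n i) / 2 ^ n) * (real (F n i c) / 2 ^ n)) \<longlonglongrightarrow> b i"
      unfolding b_def if_P[OF True] by (intro tendsto_mult lw(3) F)
    moreover have "\<forall>\<^sub>F n in sequentially. (real (lw n i) / 2 ^ n) * (real (F n i c) / 2 ^ n) = a i n"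
      using eventually_seen_fresh[OF True] eventually_gt_at_top[of i] by eventually_elim (simp add: a_def)
    ultimately show ?thesis by (rule Lim_transform_eventually)
  next
    case False
    then have "a i n = 0" for n unfolding a_def using seen_freshD by auto
    then show ?thesis using False by (simp add: b_def)
  qed
  have "(\<lambda>n. suminf (\<lambda>i. a i n)) \<longlonglongrightarrow> suminf b"
  proof (rule tannerys_theorem[THEN conjunct2, THEN conjunct2, OF lim])
    show "summable (\<lambda>i. if fresh i then w (\<nu>s i) * B else 0)"
      using W_eq_suminf(1)[OF bounded_on_M_const[of B]] .
    have "norm (a i n) \<le> (if fresh i then w (\<nu>s i) * B else 0)" for i n
    proof (cases "i < n \<and> seen_fresh n i")
      case True
      then show ?thesis using seen_freshD[of n i] lw(2)[of n i] bound[of n i] w_pos[of "\<nu>s i"]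
        by (auto simp: a_def abs_mult intro!: mult_mono simp del: times_divide_eq_left times_divide_eq_right)
    qed (use B0 w_pos[of "\<nu>s i"] in \<open>auto simp: a_def\<close>)
    then show "\<forall>\<^sub>F (i, n) in sequentially \<times>\<^sub>F sequentially. norm (a i n) \<le> (if fresh i then w (\<nu>s i) * B else 0)"
      by (auto intro!: always_eventually)
  qed simp
  moreover have "suminf b = W f" using W_eq_suminf(2)[OF bf] unfolding b_def by simp
  ultimately have lim_a: "(\<lambda>n. suminf (\<lambda>i. a i n)) \<longlonglongrightarrow> W f" by simp
  \<comment> \<open>The integer division in \<open>mix\<close> shifts the value by at most
    \<open>1 / 2 ^ n\<close>.\<close>
  have "(\<lambda>n. real (mix F n c) / 2 ^ n - suminf (\<lambda>i. a i n)) \<longlonglongrightarrow> 0"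
  proof (rule Lim_null_comparison[OF _ tendsto_half_power], rule always_eventually, rule allI)
    fix n
    define s where "s = (\<Sum>i<n. if seen_fresh n i then lw n i * F n i c else 0)"
    have "suminf (\<lambda>i. a i n) = (\<Sum>i<n. a i n)"
      by (rule suminf_finite) (auto simp: a_def)
    also have "\<dots> = real s / (2 ^ n * 2 ^ n)"
      unfolding s_def of_nat_sum sum_divide_distrib by (rule sum.cong) (auto simp: a_def)
    finally have sum: "suminf (\<lambda>i. a i n) = real s / 2 ^ n / 2 ^ n" by simp
    have m: "mix F n c = s div Suc (2 ^ n - 1)" by (simp add: mix_def s_def)
    have "Suc (2 ^ n - 1) = (2::nat) ^ n" by simp
    then have "real (Suc (2 ^ n - 1)) = 2 ^ n" by (metis of_nat_numeral of_nat_power)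
    then have "real (mix F n c) \<le> real s / 2 ^ n" "real s / 2 ^ n < real (mix F n c) + 1"
      using real_div_Suc[of s "2 ^ n - 1"] unfolding m by (simp_all del: of_nat_Suc Suc_pred)
    then have "\<bar>real (mix F n c) - real s / 2 ^ n\<bar> \<le> 1" by linarith
    then have "\<bar>real (mix F n c) - real s / 2 ^ n\<bar> / 2 ^ n \<le> 1 / 2 ^ n" by (intro divide_right_mono) auto
    then show "norm (real (mix F n c) / 2 ^ n - suminf (\<lambda>i. a i n)) \<le> 1 / 2 ^ n"
      unfolding sum diff_divide_distrib[symmetric] by (simp only: real_norm_def abs_divide) simp
  qed
  from tendsto_add[OF this lim_a] show ?thesis by simp
qed

end

section \<open>Entropy and information\<close>

lemma (in universal_mixture) bounded_ent: "bounded_on_M (\<lambda>\<nu>. ent (\<nu> h))"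
  by (rule bounded_on_MI[of _ 2]) (use \<nu>_bounds ent_nonneg ent_le_2 in auto)

text \<open>Splitting the logarithm of the quotient gives
  \<open>ent (\<xi> (h @ z)) + log 2 (\<xi> h) * \<xi> (h @ z)\<close>. As \<xi> is a measure, the
  second part sums to \<open>\<xi> h * log 2 (\<xi> h)\<close> under every policy.\<close>

lemma xi_mult_V_Ent:
  assumes \<xi>: "chron_semimeasure \<xi>" and sum: "\<And>h a. (\<Sum>e\<in>UNIV. \<xi> (h @ [(a, e)])) = \<xi> h"
    and pos: "\<xi> h > 0" and len: "length h < M"
  shows "\<xi> h * V_Ent \<xi> \<pi> M h = leaf_sum (\<lambda>h. ent (\<xi> h)) \<pi> (M - length h) h - ent (\<xi> h)"
proof -
  define c where "c = log 2 (\<xi> h)"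
  have summand: "\<xi> h * (cont_prob \<xi> \<pi> h z * - log 2 (\<xi> (h @ z) / \<xi> h)) =
    (if follows \<pi> h z then ent (\<xi> (h @ z)) + c * \<xi> (h @ z) else 0)" for z
  proof (cases "\<xi> (h @ z) = 0")
    case False
    then have "\<xi> (h @ z) > 0" using chron_semimeasureD(1)[OF \<xi>, of "h @ z"] by simp
    then show ?thesis using pos
      by (simp add: cont_prob_eq[OF \<xi> pos] ent_def c_def log_divide right_diff_distrib)
  qed (simp add: cont_prob_eq[OF \<xi> pos])
  have "\<xi> h * V_Ent \<xi> \<pi> M h = (\<Sum>z | length z = M - length h.
      if follows \<pi> h z then ent (\<xi> (h @ z)) + c * \<xi> (h @ z) else 0)"
    unfolding summand[symmetric] V_Ent_def using len by (simp add: sum_distrib_left)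
  also have "\<dots> = leaf_sum (\<lambda>h. ent (\<xi> h)) \<pi> (M - length h) h + c * \<xi> h"
    by (simp add: sum_follows[where G = "\<lambda>h. ent (\<xi> h) + c * \<xi> h"] leaf_sum_add leaf_sum_cmult
        leaf_sum_measure[OF sum])
  finally show ?thesis by (simp add: c_def ent_def)
qed

context universal_mixture
begin

definition \<phi> :: "('a, 'e) history \<Rightarrow> real" where
  "\<phi> h = ent (\<xi> h) - W (\<lambda>\<nu>. ent (\<nu> h))"

lemma W_ent_le: "W (\<lambda>\<nu>. ent (\<nu> h)) \<le> 2"
proof -
  have "W (\<lambda>\<nu>. ent (\<nu> h)) \<le> W (\<lambda>\<nu>. 2 * 1)"
    by (rule W_mono) (auto intro: bounded_ent bounded_on_M_const ent_le_2 \<nu>_bounds)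
  also have "\<dots> \<le> 2" using w_sum unfolding W_cmult by (simp add: W_def)
  finally show ?thesis .
qed

lemma \<phi>_bound: "-2 \<le> \<phi> h"
  using W_ent_le[of h] ent_nonneg[of "\<xi> h"] chron_semimeasureD(1,2)[OF semimeasure_\<xi>] unfolding \<phi>_def by force

lemma \<phi>_null: "\<xi> h = 0 \<Longrightarrow> \<phi> h = 0"
proof -
  assume "\<xi> h = 0"
  then have "W (\<lambda>\<nu>. ent (\<nu> h)) = W (\<lambda>\<nu>. 0)" by (intro W_cong) (simp add: \<nu>_eq_0_if_\<xi>_eq_0)
  then show ?thesis using \<open>\<xi> h = 0\<close> by (simp add: \<phi>_def W_def)
qed

lemma mult_KL_div:
  assumes \<nu>: "\<nu> \<in> M" and pos: "\<xi> h > 0"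
  shows "\<nu> h * KL_div m \<nu> \<xi> \<pi> h =
    (\<Sum>z | length z = m - length h. if follows \<pi> h z then - ent (\<nu> (h @ z)) - log 2 (\<xi> (h @ z)) * \<nu> (h @ z) else 0)
    + log 2 (\<xi> h) * \<nu> h + ent (\<nu> h)"
proof -
  have semi: "chron_semimeasure \<nu>" by (rule semimeasures[OF \<nu>])
  define G where "G z = - ent (\<nu> (h @ z)) - log 2 (\<xi> (h @ z)) * \<nu> (h @ z)" for z
  show ?thesis
  proof (cases "\<nu> h = 0")
    \<comment> \<open>Conditioning on a history that is null for \<nu> is meaningless, but the
      factor \<open>\<nu> h\<close> removes it.\<close>
    case True
    then have "\<nu> (h @ z) = 0" for z using semimeasure_append_eq_0[OF semi] by blast
    then show ?thesis using True by (simp cong: if_cong)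
  next
    case False
    then have \<nu>pos: "\<nu> h > 0" using chron_semimeasureD(1)[OF semi, of h] by simp
    define c where "c = log 2 (\<xi> h) - log 2 (\<nu> h)"
    have summand: "\<nu> h * (if cont_prob \<nu> \<pi> h z = 0 then 0
        else cont_prob \<nu> \<pi> h z * log 2 (cont_prob \<nu> \<pi> h z / cont_prob \<xi> \<pi> h z)) =
      (if follows \<pi> h z then G z else 0) + (if follows \<pi> h z then c * \<nu> (h @ z) else 0)" for z
    proof (cases "\<nu> (h @ z) = 0")
      case True
      then show ?thesis by (simp add: cont_prob_eq[OF semi \<nu>pos] G_def)
    next
      case False
      then have 1: "\<nu> (h @ z) > 0" using chron_semimeasureD(1)[OF semi, of "h @ z"] by simp
      \<comment> \<open>Every \<nu> is dominated by the mixture, so the logarithm is taken of a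
        positive quotient.\<close>
      have "\<xi> (h @ z) \<noteq> 0" using \<nu>_eq_0_if_\<xi>_eq_0[OF _ \<nu>] False by blast
      then have 2: "\<xi> (h @ z) > 0" using chron_semimeasureD(1)[OF semimeasure_\<xi>, of "h @ z"] by simp
      have log: "log 2 ((\<nu> (h @ z) / \<nu> h) / (\<xi> (h @ z) / \<xi> h)) =
          log 2 (\<nu> (h @ z)) - log 2 (\<nu> h) - (log 2 (\<xi> (h @ z)) - log 2 (\<xi> h))"
        using 1 2 pos \<nu>pos by (simp add: log_divide log_mult)
      show ?thesis
      proof (cases "follows \<pi> h z")
        case True
        then have "\<nu> h * (if cont_prob \<nu> \<pi> h z = 0 then 0
            else cont_prob \<nu> \<pi> h z * log 2 (cont_prob \<nu> \<pi> h z / cont_prob \<xi> \<pi> h z)) =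
          \<nu> (h @ z) * log 2 ((\<nu> (h @ z) / \<nu> h) / (\<xi> (h @ z) / \<xi> h))"
          using 1 \<nu>pos by (simp add: cont_prob_eq[OF semi \<nu>pos] cont_prob_eq[OF semimeasure_\<xi> pos])
        also have "\<dots> = G z + c * \<nu> (h @ z)"
          unfolding log G_def ent_def c_def by (simp add: algebra_simps)
        finally show ?thesis using True by simp
      qed (simp add: cont_prob_eq[OF semi \<nu>pos])
    qed
    have "\<nu> h * KL_div m \<nu> \<xi> \<pi> h = (\<Sum>z | length z = m - length h. if follows \<pi> h z then G z else 0)
       + (\<Sum>z | length z = m - length h. if follows \<pi> h z then c * \<nu> (h @ z) else 0)"
      unfolding KL_div_def sum_distrib_left summand sum.distrib ..
    also have "(\<Sum>z | length z = m - length h. if follows \<pi> h z then c * \<nu> (h @ z) else 0) = c * \<nu> h"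
      by (simp add: sum_follows[where G = "\<lambda>h. c * \<nu> h"] leaf_sum_cmult leaf_sum_measure sum_\<nu>[OF \<nu>])
    finally show ?thesis unfolding G_def[symmetric] by (simp add: c_def ent_def[of "\<nu> h"] algebra_simps)
  qed
qed

text \<open>
  Once multiplied by \<open>\<xi> h\<close>, the Bayes weights cancel against the normalisation of \<open>\<nu>\<close>: what
  remains is the mutual information, i.e. entropy minus expected entropy.
\<close>

lemma \<xi>_mult_V_IG:
  assumes pos: "\<xi> h > 0" and len: "length h < m"
  shows "\<xi> h * V_IG w M \<pi> m h = leaf_sum \<phi> \<pi> (m - length h) h - \<phi> h"
proof -
  let ?Z = "{z. length z = m - length h}"
  let ?A = "\<lambda>\<nu> z. if follows \<pi> h z then - ent (\<nu> (h @ z)) - log 2 (\<xi> (h @ z)) * \<nu> (h @ z) else 0"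
  have bent: "bounded_on_M (\<lambda>\<nu>. - ent (\<nu> h))" for h
    using bounded_on_M_cmult[OF bounded_ent[of h], of "-1"] by simp
  have bA: "bounded_on_M (\<lambda>\<nu>. ?A \<nu> z)" for z
  proof (cases "follows \<pi> h z")
    case True
    have "bounded_on_M (\<lambda>\<nu>. - ent (\<nu> (h @ z)) + (- log 2 (\<xi> (h @ z))) * \<nu> (h @ z))"
      by (intro bounded_on_M_add bounded_on_M_cmult bent bounded_\<nu>)
    then show ?thesis using True by simp
  qed (simp add: bounded_on_M_const)
  have WA: "W (\<lambda>\<nu>. ?A \<nu> z) = (if follows \<pi> h z then \<phi> (h @ z) else 0)" for z
  proof (cases "follows \<pi> h z")
    case True
    have "W (\<lambda>\<nu>. (-1) * ent (\<nu> (h @ z)) + (- log 2 (\<xi> (h @ z))) * \<nu> (h @ z)) = \<phi> (h @ z)"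
      unfolding W_add[OF bounded_on_M_cmult[OF bounded_ent] bounded_on_M_cmult[OF bounded_\<nu>]] W_cmult
        \<xi>_eq[symmetric] \<phi>_def ent_def[of "\<xi> (h @ z)"] by (simp add: mult.commute)
    then show ?thesis using True by simp
  qed (simp add: W_def)
  have "\<xi> h * V_IG w M \<pi> m h = (\<Sum>\<^sub>\<infinity>\<nu>\<in>M. \<xi> h * (posterior w M \<nu> h * KL_div m \<nu> \<xi> \<pi> h))"
    unfolding V_IG_def \<xi>[symmetric] using len by (simp add: infsum_cmult_right')
  also have "\<dots> = W (\<lambda>\<nu>. \<nu> h * KL_div m \<nu> \<xi> \<pi> h)"
    unfolding W_def posterior_def \<xi>[symmetric] using pos by (intro infsum_cong) simp
  also have "\<dots> = W (\<lambda>\<nu>. (\<Sum>z\<in>?Z. ?A \<nu> z) + log 2 (\<xi> h) * \<nu> h + ent (\<nu> h))"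
    by (rule W_cong) (rule mult_KL_div[OF _ pos])
  \<comment> \<open>Only finitely many \<open>z\<close> occur and each summand is bounded on
    \<open>M\<close>, so \<open>W\<close> may be taken inside. It turns \<open>\<nu> (h @ z)\<close>
    into \<open>\<xi> (h @ z)\<close> and so completes \<open>\<phi>\<close>.\<close>
  also have "\<dots> = (\<Sum>z\<in>?Z. W (\<lambda>\<nu>. ?A \<nu> z)) + log 2 (\<xi> h) * \<xi> h + W (\<lambda>\<nu>. ent (\<nu> h))"
    by (simp add: W_add W_sum W_cmult bA bounded_on_M_add bounded_on_M_sum bounded_on_M_cmult bounded_ent
        bounded_\<nu> \<xi>_eq[symmetric] del: sum.If_cases)
  also have "(\<Sum>z\<in>?Z. W (\<lambda>\<nu>. ?A \<nu> z)) = leaf_sum \<phi> \<pi> (m - length h) h"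
    unfolding WA by (rule sum_follows)
  finally show ?thesis unfolding \<phi>_def ent_def by simp
qed

end

context approximated_mixture
begin

abbreviation lower :: "nat \<Rightarrow> nat \<Rightarrow> nat \<Rightarrow> nat" where
  "lower n i c \<equiv> L n (prod_encode (i, c))"

lemma lower_le: "real (lower n i (hist_code (h :: ('a, 'e) history))) / 2 ^ n \<le> 1"
  by (rule order_trans[OF L(2)[of n i h] \<nu>_bounds(2)[of "\<nu>s i" h]]) simp

lemma tendsto_\<xi>: "(\<lambda>n. real (mix lower n (hist_code h)) / 2 ^ n) \<longlonglongrightarrow> \<xi> h"
  unfolding \<xi>_eq by (rule tendsto_mix[where f = "\<lambda>\<nu>. \<nu> h" and F = lower and B = 1, OF L(3) lower_le])

lemma computable_lower: "computable_fun3 lower"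
  by (intro computable_intros computable_fun2_compose[OF L(1)])

text \<open>Since all weights are positive, the support of \<xi> is the union of the supports of the
  \<open>\<nu>s i\<close>, and a positive lower bound certifies membership; \<open>n\<close> codes a
  stage and an index.\<close>

lemma \<xi>_pos_iff: "\<xi> h > 0 \<longleftrightarrow> (\<exists>n. 0 < lower (fst (prod_decode n)) (snd (prod_decode n)) (hist_code h))"
proof
  assume pos: "\<xi> h > 0"
  have "\<exists>i. \<nu>s i h > 0"
  proof (rule ccontr)
    assume "\<nexists>i. \<nu>s i h > 0"
    then have "\<nu>s i h = 0" for i using \<nu>_bounds(1)[of "\<nu>s i" h] by (auto simp: not_less intro: antisym)
    then have "\<nu> h = 0" if "\<nu> \<in> M" for \<nu> using that unfolding M by auto
    then have "\<xi> h = W (\<lambda>\<nu>. 0)" unfolding \<xi>_eq by (rule W_cong)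
    then show False using pos by (simp add: W_def)
  qed
  then obtain i where "\<nu>s i h > 0" by blast
  then have "\<forall>\<^sub>F n in sequentially. 0 < real (lower n i (hist_code h)) / 2 ^ n"
    by (rule order_tendstoD(1)[OF L(3)])
  then obtain n where "0 < real (lower n i (hist_code h)) / 2 ^ n"
    by (meson eventually_at_top_linorder order_refl)
  then have "0 < lower n i (hist_code h)" by (simp add: zero_less_divide_iff)
  then show "\<exists>n. 0 < lower (fst (prod_decode n)) (snd (prod_decode n)) (hist_code h)"
    by (intro exI[of _ "prod_encode (n, i)"]) simp
next
  assume "\<exists>n. 0 < lower (fst (prod_decode n)) (snd (prod_decode n)) (hist_code h)"
  then obtain n i where "0 < lower n i (hist_code h)" by blast
  then have "0 < real (lower n i (hist_code h)) / 2 ^ n" by simp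
  then have "\<nu>s i h \<noteq> 0" using L(2)[of n i h] by linarith
  then have "\<xi> h \<noteq> 0" using \<nu>_eq_0_if_\<xi>_eq_0[of h "\<nu>s i"] by auto
  then show "\<xi> h > 0" using chron_semimeasureD(1)[OF semimeasure_\<xi>, of h] by simp
qed

lemma approximable_V_Ent:
  assumes "computable_fun m"
  shows "approximable_value \<xi> (\<lambda>h. ent (\<xi> h)) (V_Ent \<xi>) m (\<lambda>m h. ent (\<xi> h)) 0
     (\<lambda>n c. ent_code n (mix lower n c)) (mix lower)
     (\<lambda>n c. 0 < lower (fst (prod_decode n)) (snd (prod_decode n)) c)"
proof
  show "computable_fun2 (\<lambda>n c. ent_code n (mix lower n c))"
    by (intro computable_intros computable_fun2_compose[OF computable_fun_mix[OF computable_lower]])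
  show "computable_pred2 (\<lambda>n c. 0 < lower (fst (prod_decode n)) (snd (prod_decode n)) c)"
    by (intro computable_intros computable_fun2_compose[OF L(1)])
  show "(\<lambda>n. real (ent_code n (mix lower n (hist_code h))) / 2 ^ n) \<longlonglongrightarrow> ent (\<xi> h)" for h
    by (rule tendsto_ent_code[OF tendsto_\<xi> chron_semimeasureD(2)[OF semimeasure_\<xi>]])
qed (use assms measure tendsto_\<xi> computable_fun_mix[OF computable_lower] \<xi>_pos_iff
    xi_mult_V_Ent[OF semimeasure_\<xi> sum_\<xi>] in \<open>auto simp: V_Ent_def\<close>)

text \<open>
  The offset \<open>2\<close> makes \<open>\<phi>\<close> nonnegative, so that truncated subtraction of approximations is harmless.
\<close>

lemma approximable_V_IG:
  assumes "computable_fun m"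
  shows "approximable_value \<xi> (\<lambda>h. 2 + \<phi> h) (V_IG w M) m
     (\<lambda>m h. real (CARD('e) ^ (m - length h)) * 2 + \<phi> h) 2
     (\<lambda>n c. 2 * 2 ^ n + ent_code n (mix lower n c) - mix (\<lambda>n i c. ent_code n (lower n i c)) n c) (mix lower)
     (\<lambda>n c. 0 < lower (fst (prod_decode n)) (snd (prod_decode n)) c)"
proof
  have c: "computable_fun3 (\<lambda>n i c. ent_code n (lower n i c))"
    by (intro computable_intros computable_fun2_compose[OF L(1)])
  show "computable_fun2 (\<lambda>n c. 2 * 2 ^ n + ent_code n (mix lower n c) - mix (\<lambda>n i c. ent_code n (lower n i c)) n c)"
    by (intro computable_intros computable_fun2_compose[OF computable_fun_mix[OF computable_lower]]
        computable_fun2_compose[OF computable_fun_mix[OF c]])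
  show "computable_pred2 (\<lambda>n c. 0 < lower (fst (prod_decode n)) (snd (prod_decode n)) c)"
    by (intro computable_intros computable_fun2_compose[OF L(1)])
  show "(\<lambda>n. real (2 * 2 ^ n + ent_code n (mix lower n (hist_code h))
      - mix (\<lambda>n i c. ent_code n (lower n i c)) n (hist_code h)) / 2 ^ n) \<longlonglongrightarrow> 2 + \<phi> h" for h
  proof -
    have sub: "real (2 * 2 ^ n + a - b) / 2 ^ n = max (2 + real a / 2 ^ n - real b / 2 ^ n) 0" for n a b :: nat
    proof -
      have "real (x - b) = max (real x - real b) 0" for x by (cases "b \<le> x") (auto simp: of_nat_diff)
      from this[of "2 * 2 ^ n + a"] have "real (2 * 2 ^ n + a - b) = max (2 * 2 ^ n + real a - real b) 0" by simp
      moreover have "max x 0 / 2 ^ n = max (x / 2 ^ n) 0" for x :: real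
        by (simp add: max_divide_distrib_right)
      ultimately show ?thesis by (simp add: add_divide_distrib diff_divide_distrib)
    qed
    have 1: "(\<lambda>n. real (ent_code n (mix lower n (hist_code h))) / 2 ^ n) \<longlonglongrightarrow> ent (\<xi> h)"
      by (rule tendsto_ent_code[OF tendsto_\<xi> chron_semimeasureD(2)[OF semimeasure_\<xi>]])
    have 2: "(\<lambda>n. real (mix (\<lambda>n i c. ent_code n (lower n i c)) n (hist_code h)) / 2 ^ n) \<longlonglongrightarrow> W (\<lambda>\<nu>. ent (\<nu> h))"
    proof (rule tendsto_mix)
      show "(\<lambda>n. real (ent_code n (lower n i (hist_code h))) / 2 ^ n) \<longlonglongrightarrow> ent (\<nu>s i h)" for i
        by (rule tendsto_ent_code[OF L(3)]) (simp add: \<nu>_bounds)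
    qed (rule ent_code_le)
    have "max (2 + ent (\<xi> h) - W (\<lambda>\<nu>. ent (\<nu> h))) 0 = 2 + \<phi> h"
      using \<phi>_bound[of h] by (simp add: \<phi>_def)
    then show ?thesis unfolding sub
      using tendsto_max[OF tendsto_diff[OF tendsto_add[OF tendsto_const[of 2] 1] 2] tendsto_const[of 0]] by simp
  qed
  \<comment> \<open>The offset contributes 2 for each of the
    \<open>CARD('e) ^ (m - length h)\<close> reachable leaves under any policy and is absorbed into
    \<open>C\<close>.\<close>
  show "\<xi> h * V_IG w M \<pi> m h = leaf_sum (\<lambda>h. 2 + \<phi> h) \<pi> (m - length h) h
      - (real (CARD('e) ^ (m - length h)) * 2 + \<phi> h)" if "\<xi> h > 0" "length h < m" for \<pi> m h
    using \<xi>_mult_V_IG[OF that, of \<pi>] by (simp add: leaf_sum_add leaf_sum_const)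
qed (use assms measure tendsto_\<xi> computable_fun_mix[OF computable_lower] \<xi>_pos_iff \<phi>_null
    in \<open>auto simp: V_IG_def\<close>)

end

theorem corollary6p25:
  fixes \<nu>s :: "nat \<Rightarrow> ('a::finite, 'e::finite) env"
    and M :: "('a, 'e) env set"
    and w :: "('a, 'e) env \<Rightarrow> real"
    and \<xi> :: "('a, 'e) env"
    and m :: "nat \<Rightarrow> nat"
  assumes M: "M = range \<nu>s"
    and semimeasures: "\<And>\<nu>. \<nu> \<in> M \<Longrightarrow> chron_semimeasure \<nu>"
    and lsc: "uniformly_lower_semicomputable \<nu>s"
    and prior: "positive_prior M w"
    and prior_lsc: "lower_semicomputable (\<lambda>i. i) (\<lambda>i. w (\<nu>s i))"
    and \<xi>: "\<xi> = mixture w M"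
    and measure: "chron_measure \<xi>"
    and m_computable: "computable_fun m"
    and m_ge: "\<And>t. m t \<ge> t"
  shows "\<forall>V \<in> {V_Ent \<xi>, V_IG w M}.
    (\<forall>\<epsilon>>0. \<exists>\<pi>. delta0 2 (policies_graph \<pi>) \<and>
       (\<forall>t h. \<xi> h > 0 \<longrightarrow> opt_value V (m t) h - V (\<pi> t) (m t) h < \<epsilon>)) \<and>
    (\<exists>\<pi>. delta0 3 (policies_graph \<pi>) \<and>
       (\<forall>t h. \<xi> h > 0 \<longrightarrow> V (\<pi> t) (m t) h = opt_value V (m t) h))"
proof -
  interpret universal_mixture \<nu>s M w \<xi>
    by (rule universal_mixture.intro[OF M semimeasures lsc prior prior_lsc \<xi> measure])
  obtain L lw where "approximated_mixture \<nu>s M w \<xi> L lw" using ex_approximated_mixture by blast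
  then interpret approximated_mixture \<nu>s M w \<xi> L lw .
  interpret Ent: approximable_value \<xi> "\<lambda>h. ent (\<xi> h)" "V_Ent \<xi>" m "\<lambda>m h. ent (\<xi> h)" 0
    "\<lambda>n c. ent_code n (mix lower n c)" "mix lower"
    "\<lambda>n c. 0 < lower (fst (prod_decode n)) (snd (prod_decode n)) c"
    by (rule approximable_V_Ent[OF m_computable])
  interpret IG: approximable_value \<xi> "\<lambda>h. 2 + \<phi> h" "V_IG w M" m
    "\<lambda>m h. real (CARD('e) ^ (m - length h)) * 2 + \<phi> h" 2
    "\<lambda>n c. 2 * 2 ^ n + ent_code n (mix lower n c) - mix (\<lambda>n i c. ent_code n (lower n i c)) n c" "mix lower"
    "\<lambda>n c. 0 < lower (fst (prod_decode n)) (snd (prod_decode n)) c"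
    by (rule approximable_V_IG[OF m_computable])
  show ?thesis
    using Ent.eps_optimal_policies Ent.optimal_policies IG.eps_optimal_policies IG.optimal_policies by blast
qed

end
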